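(* Let $G=(G^1,\dots,G^N)\in(W_0(\mathbb{R}))^N$ have stable integer shifts and let $\vec\Lambda=(\Lambda^1,\dots,\Lambda^N)$ be a tuple of separated subsets of $\mathbb{R}$. Then the following are equivalent: (a) $\vec\Lambda$ is a sampling set for $V^p(G)$ for some $p\in[1,\infty]$; (b) $\vec\Lambda$ is a sampling set for $V^p(G)$ for all $p\in[1,\infty]$; (c) every weak limit $\vec\Gamma\in W_{\mathbb{Z}}(\vec\Lambda)$ is a sampling set for $V^\infty(G)$; (d) every weak limit $\vec\Gamma\in W_{\mathbb{Z}}(\vec\Lambda)$ is a set of uniqueness for $V^\infty(G)$.
   Context: $W_0(\mathbb{R})$ is the space of continuous $g:\mathbb{R}\to\mathbb{C}$ with $\sum_{k\in\mathbb{Z}}\max_{x\in[k,k+1]}|g(x)|<\infty$. For $G=(G^1,\dots,G^N)$, $V^p(G)=\{\sum_{k\in\mathbb{Z}}c_kG(\cdot-k):c\in\ell^p(\mathbb{Z})\}\subseteq(L^p(\mathbb{R}))^N$ with norm $\|F\|_p=(\sum_{j=1}^N\|F^j\|_p^p)^{1/p}$ for $p<\infty$ and $\|F\|_\infty=\max_j\|F^j\|_\infty$. $G$ has stable integer shifts if $\|\sum_kc_kG(\cdot-k)\|_p\asymp\|c\|_p$ (two-sided bounds with constants independent of $c$) for $c\in\ell^p(\mathbb{Z})$, $1\le p\le\infty$. A set is separated if distinct points have mutual distance bounded below by a positive constant. $\vec\Lambda$ is a sampling set for $V^p(G)$ if $\|F\|_p\asymp(\sum_{j=1}^N\sum_{\lambda\in\Lambda^j}|F^j(\lambda)|^p)^{1/p}$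 for all $F\in V^p(G)$ (for $p=\infty$: $\|F\|_\infty\asymp\max_j\sup_{\lambda\in\Lambda^j}|F^j(\lambda)|$). $\vec\Lambda$ is a uniqueness set for $V^p(G)$ if $F\in V^p(G)$ and $F^j\equiv0$ on $\Lambda^j$ for all $j$ imply $F\equiv0$. A sequence of sets $\Lambda_n\subseteq\mathbb{R}$ converges weakly to $\Lambda$ if for every bounded open interval $(a,b)$ and $\varepsilon>0$ there is $n_0$ such that for $n\ge n_0$: $\Lambda_n\cap(a,b)\subseteq\Lambda+(-\varepsilon,\varepsilon)$ and $\Lambda\cap(a,b)\subseteq\Lambda_n+(-\varepsilon,\varepsilon)$. $\vec\Gamma=(\Gamma^1,\dots,\Gamma^N)\in W_{\mathbb{Z}}(\vec\Lambda)$ if there is a sequence $(k_n)\subseteq\mathbb{Z}$ such that $\Lambda^j+k_n$ converges weakly to $\Gamma^j$ for all $1\le j\le N$ (same sequence for all $j$). *)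

theory Defs
  imports "HOL-Analysis.Analysis"
begin

text \<open>Vector-valued objects with N components are represented as functions
  indexed by j :: nat, only the components j < N being relevant.
  The exponent p ranges over [1,\<infinity>] and is modelled as an ennreal with p = top
  standing for p = \<infinity>.  All norms are ennreal-valued (possibly top).\<close>

definition W0 :: "(real \<Rightarrow> complex) \<Rightarrow> bool" where
  "W0 g \<longleftrightarrow> continuous_on UNIV g \<and>
     (\<lambda>k::int. Sup ((\<lambda>x. norm (g x)) ` {real_of_int k .. real_of_int k + 1})) summable_on UNIV"

definition enn_root :: "ennreal \<Rightarrow> ennreal \<Rightarrow> ennreal" where
  "enn_root p x = (if x = top then top else ennreal (enn2real x powr (1 / enn2real p)))"

definition lp_norm :: "ennreal \<Rightarrow> (int \<Rightarrow> complex) \<Rightarrow> ennreal" where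
  "lp_norm p c = (if p = top then (SUP k. ennreal (norm (c k)))
     else enn_root p (\<Sum>\<^sub>\<infinity>k. ennreal (norm (c k) powr enn2real p)))"

definition synth :: "(nat \<Rightarrow> real \<Rightarrow> complex) \<Rightarrow> (int \<Rightarrow> complex) \<Rightarrow> nat \<Rightarrow> real \<Rightarrow> complex" where
  "synth G c j x = (\<Sum>\<^sub>\<infinity>k. c k * G j (x - real_of_int k))"

definition Vp :: "nat \<Rightarrow> ennreal \<Rightarrow> (nat \<Rightarrow> real \<Rightarrow> complex) \<Rightarrow> (nat \<Rightarrow> real \<Rightarrow> complex) set" where
  "Vp N p G = {F. \<exists>c. lp_norm p c < top \<and> (\<forall>j<N. F j = synth G c j)}"

text \<open>(L^p(R))^N norm; for p = infinity the sup norm (the functions involved are continuous).\<close>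
definition Lp_norm :: "nat \<Rightarrow> ennreal \<Rightarrow> (nat \<Rightarrow> real \<Rightarrow> complex) \<Rightarrow> ennreal" where
  "Lp_norm N p F = (if p = top then (SUP j\<in>{..<N}. SUP x. ennreal (norm (F j x)))
     else enn_root p (\<Sum>j<N. \<integral>\<^sup>+ x. ennreal (norm (F j x) powr enn2real p) \<partial>lborel))"

definition samp_norm :: "nat \<Rightarrow> ennreal \<Rightarrow> (nat \<Rightarrow> real set) \<Rightarrow> (nat \<Rightarrow> real \<Rightarrow> complex) \<Rightarrow> ennreal" where
  "samp_norm N p \<Lambda> F = (if p = top then (SUP j\<in>{..<N}. SUP l\<in>\<Lambda> j. ennreal (norm (F j l)))
     else enn_root p (\<Sum>j<N. \<Sum>\<^sub>\<infinity>l\<in>\<Lambda> j. ennreal (norm (F j l) powr enn2real p)))"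

definition stable_shifts :: "nat \<Rightarrow> (nat \<Rightarrow> real \<Rightarrow> complex) \<Rightarrow> bool" where
  "stable_shifts N G \<longleftrightarrow> (\<forall>p::ennreal. 1 \<le> p \<longrightarrow>
     (\<exists>A B::real. 0 < A \<and> 0 < B \<and> (\<forall>c. lp_norm p c < top \<longrightarrow>
        ennreal A * lp_norm p c \<le> Lp_norm N p (synth G c) \<and>
        Lp_norm N p (synth G c) \<le> ennreal B * lp_norm p c)))"

definition separated :: "real set \<Rightarrow> bool" where
  "separated S \<longleftrightarrow> (\<exists>\<delta>>0. \<forall>x\<in>S. \<forall>y\<in>S. x \<noteq> y \<longrightarrow> \<delta> \<le> \<bar>x - y\<bar>)"

definition sampling_set :: "nat \<Rightarrow> ennreal \<Rightarrow> (nat \<Rightarrow> real \<Rightarrow> complex) \<Rightarrow> (nat \<Rightarrow> real set) \<Rightarrow> bool" where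
  "sampling_set N p G \<Lambda> \<longleftrightarrow> (\<exists>A B::real. 0 < A \<and> 0 < B \<and> (\<forall>F\<in>Vp N p G.
     ennreal A * Lp_norm N p F \<le> samp_norm N p \<Lambda> F \<and>
     samp_norm N p \<Lambda> F \<le> ennreal B * Lp_norm N p F))"

definition uniqueness_set :: "nat \<Rightarrow> ennreal \<Rightarrow> (nat \<Rightarrow> real \<Rightarrow> complex) \<Rightarrow> (nat \<Rightarrow> real set) \<Rightarrow> bool" where
  "uniqueness_set N p G \<Lambda> \<longleftrightarrow> (\<forall>F\<in>Vp N p G.
     (\<forall>j<N. \<forall>l\<in>\<Lambda> j. F j l = 0) \<longrightarrow> (\<forall>j<N. \<forall>x. F j x = 0))"

definition eps_nbhd :: "real set \<Rightarrow> real \<Rightarrow> real set" where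
  "eps_nbhd S \<epsilon> = {y. \<exists>x\<in>S. \<bar>y - x\<bar> < \<epsilon>}"

definition weak_conv :: "(nat \<Rightarrow> real set) \<Rightarrow> real set \<Rightarrow> bool" where
  "weak_conv Ls L \<longleftrightarrow> (\<forall>a b \<epsilon>. \<epsilon> > 0 \<longrightarrow> (\<exists>n0. \<forall>n\<ge>n0.
     Ls n \<inter> {a<..<b} \<subseteq> eps_nbhd L \<epsilon> \<and> L \<inter> {a<..<b} \<subseteq> eps_nbhd (Ls n) \<epsilon>))"

definition WZ :: "nat \<Rightarrow> (nat \<Rightarrow> real set) \<Rightarrow> (nat \<Rightarrow> real set) set" where
  "WZ N \<Lambda> = {\<Gamma>. \<exists>k::nat \<Rightarrow> int. \<forall>j<N.
     weak_conv (\<lambda>n. (\<lambda>x. x + real_of_int (k n)) ` \<Lambda> j) (\<Gamma> j)}"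

end

theory Submission
  imports Defs "HOL-Library.Diagonal_Subsequence"
begin

text \<open>Passing from coefficients to samples is the matrix \<open>A\<close> with entries \<open>G\<^sup>j(\<lambda> - k)\<close>, which are dominated by
  \<open>\<theta>(\<lfloor>\<lambda>\<rfloor> - k)\<close> for a summable \<open>\<theta>\<close>; by stability of the shifts, sampling for \<open>V\<^sup>p\<close> means that \<open>A\<close> is bounded
  below on \<open>\<ell>\<^sup>p\<close>. The commutator of \<open>A\<close> with a Lipschitz window of width \<open>L\<close> is dominated by the convolution
  kernel \<open>\<theta>(n) min(1, |n|/L)\<close>, whose \<open>\<ell>\<^sup>1\<close> norm \<open>\<eta>\<close> tends to 0 as \<open>L\<close> grows (Sjoestrand's argument).
  Applying a lower bound on \<open>\<ell>\<^sup>p\<close> to windowed coefficients therefore bounds local \<open>\<ell>\<^sup>p\<close> norms of \<open>c\<close> by local norms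
  of \<open>A c\<close> plus a small multiple of averaged local norms of \<open>c\<close>; the latter is absorbed in the supremum (from
  \<open>p < \<infinity>\<close> to \<open>\<infinity>\<close>) or in the \<open>\<ell>\<^sup>q\<close> sum over all windows (from \<open>\<infinity>\<close> to \<open>q < \<infinity>\<close>). The same windows localise a lower
  bound on \<open>\<ell>\<^sup>\<infinity>\<close>, so that it passes to weak limits. Conversely, if the lower bound on \<open>\<ell>\<^sup>\<infinity>\<close> fails, translates of
  almost extremal coefficients have a pointwise limit \<open>c \<noteq> 0\<close> whose function vanishes on a weak limit of \<open>\<Lambda>\<close>.\<close>

section \<open>Sums of nonnegative families and Jensen's inequality\<close>

text \<open>The four conditions are all compared with one inequality, \<open>sup_stable\<close>: a
  bounded coefficient sequence whose samples are at most \<open>D\<close> is itself at most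
  \<open>C * D\<close>. Absorbing an error term requires the absorbed quantity to be finite
  beforehand, and this decides what is absorbed where: for merely bounded coefficients the supremum
  of the local norms is finite while their sum need not be; for coefficients in l^q the sum over all
  windows is finite too. Weak convergence compares sets on bounded intervals only, while samples
  range over the whole line. Windowing removes this mismatch: the synthesised function then tends to
  0 at infinity, so distant samples are small. In the converse direction suprema need not be
  attained; moving a coefficient of more than half the supremum to position 0 keeps the pointwise
  limit nonzero. Separation bounds the number of sampling points per unit interval, which is what
  compares l^p sums over samples with sums over integers.\<close>

lemma infsum_ennreal_eq_nn_integral:
  fixes f :: "'a \<Rightarrow> ennreal"
  shows "infsum f A = (\<integral>\<^sup>+x. f x \<partial>count_space A)"
proof -
  have S: "infsum f A = (SUP F\<in>{F. finite F \<and> F \<subseteq> A}. sum f F)"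
    by (intro nonneg_infsum_complete) auto
  have fin: "sum f F \<le> (\<integral>\<^sup>+x. f x \<partial>count_space A)" if "finite F" "F \<subseteq> A" for F
  proof -
    have "sum f F = (\<integral>\<^sup>+x. f x \<partial>count_space F)"
      using that by (simp add: nn_integral_count_space_finite)
    also have "\<dots> = (\<integral>\<^sup>+x. f x * indicator F x \<partial>count_space UNIV)"
      by (simp add: nn_integral_count_space_indicator)
    also have "\<dots> \<le> (\<integral>\<^sup>+x. f x * indicator A x \<partial>count_space UNIV)"
      using that by (intro nn_integral_mono) (auto simp: indicator_def)
    also have "\<dots> = (\<integral>\<^sup>+x. f x \<partial>count_space A)"
      by (simp add: nn_integral_count_space_indicator)
    finally show ?thesis .
  qed
  have le: "infsum f A \<le> (\<integral>\<^sup>+x. f x \<partial>count_space A)"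
    unfolding S by (intro SUP_least) (use fin in auto)
  show ?thesis
  \<comment> \<open>An infinite sum is settled by \<open>le\<close>. A finite one forces every term
    to be finite, which reduces the claim to absolutely summable real families.\<close>
  proof (cases "infsum f A = top")
    case True
    then show ?thesis using le by (simp add: top_unique)
  next
    case False
    have fle: "sum f F \<le> infsum f A" if "finite F" "F \<subseteq> A" for F
      unfolding S using that by (intro SUP_upper) auto
    define g where "g = (\<lambda>x. enn2real (f x))"
    have fg: "f x = ennreal (g x)" if "x \<in> A" for x
      using fle[of "{x}"] False that unfolding g_def
      by (metis empty_subsetI ennreal_enn2real finite.emptyI finite_insert insert_subset less_top
          neq_top_trans sum.empty sum.insert add.right_neutral empty_iff)
    have sumg: "ennreal (sum g F) = sum f F" if "finite F" "F \<subseteq> A" for F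
    proof -
      have "ennreal (sum g F) = (\<Sum>x\<in>F. ennreal (g x))"
        by (rule sum_ennreal[symmetric]) (simp add: g_def)
      also have "\<dots> = sum f F"
        by (rule sum.cong) (use that fg in auto)
      finally show ?thesis .
    qed
    have summ: "g summable_on A"
    proof (rule nonneg_bdd_above_summable_on)
      show "bdd_above (sum g ` {F. F \<subseteq> A \<and> finite F})"
      proof (rule bdd_aboveI)
        fix x assume "x \<in> sum g ` {F. F \<subseteq> A \<and> finite F}"
        then obtain F where F: "F \<subseteq> A" "finite F" "x = sum g F" by auto
        have "ennreal (sum g F) \<le> infsum f A" using sumg[OF F(2,1)] fle[OF F(2,1)] by simp
        then show "x \<le> enn2real (infsum f A)" using False F(3)
          by (metis ennreal_enn2real ennreal_le_iff enn2real_nonneg less_top)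
      qed
    qed (simp add: g_def)
    have abs: "Infinite_Set_Sum.abs_summable_on g A"
      using summ abs_summable_equivalent[of g A] by (simp add: g_def)
    have "(\<integral>\<^sup>+x. f x \<partial>count_space A) = (\<integral>\<^sup>+x. ennreal (g x) \<partial>count_space A)"
      by (intro nn_integral_cong) (use fg in auto)
    also have "\<dots> = ennreal (infsum g A)"
      using nn_integral_conv_infsetsum[OF abs] infsetsum_infsum[OF abs] by (simp add: g_def)
    also have "\<dots> = (SUP F\<in>{F. finite F \<and> F \<subseteq> A}. ennreal (sum g F))"
      by (rule infsum_nonneg_is_SUPREMUM_ennreal) (use summ in \<open>auto simp: g_def\<close>)
    also have "\<dots> = infsum f A"
      unfolding S by (rule SUP_cong) (use sumg in auto)
    finally show ?thesis by simp
  qed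
qed

lemma ennreal_infsum_eq_nn_integral:
  fixes f :: "'a \<Rightarrow> real"
  assumes "f summable_on A" "\<And>x. x \<in> A \<Longrightarrow> 0 \<le> f x"
  shows "ennreal (infsum f A) = (\<integral>\<^sup>+x. ennreal (f x) \<partial>count_space A)"
proof -
  have "Infinite_Set_Sum.abs_summable_on f A"
    using assms abs_summable_equivalent[of f A]
    by (metis (no_types, lifting) summable_on_cong real_norm_def abs_of_nonneg)
  then show ?thesis
    using nn_integral_conv_infsetsum[of f A] infsetsum_infsum[of f A] assms(2) by simp
qed

text \<open>Tonelli for counting measures, with no countability assumption on the index sets: both
  sides are extended by zero and identified with one sum over pairs.\<close>

lemma nn_integral_count_space_swap:
  fixes f :: "'a \<Rightarrow> 'b \<Rightarrow> ennreal"
  shows "(\<integral>\<^sup>+x. \<integral>\<^sup>+y. f x y \<partial>count_space B \<partial>count_space A)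
       = (\<integral>\<^sup>+y. \<integral>\<^sup>+x. f x y \<partial>count_space A \<partial>count_space B)"
proof -
  let ?g = "\<lambda>(x,y). f x y * indicator A x * indicator B y"
  have "(\<integral>\<^sup>+x. \<integral>\<^sup>+y. f x y \<partial>count_space B \<partial>count_space A)
      = (\<integral>\<^sup>+x. \<integral>\<^sup>+y. ?g (x,y) \<partial>count_space UNIV \<partial>count_space UNIV)"
    by (simp add: nn_integral_count_space_indicator[symmetric] nn_integral_multc
        nn_integral_count_space_indicator mult_ac)
      (auto intro!: nn_integral_cong simp: indicator_def)
  also have "\<dots> = (\<integral>\<^sup>+y. \<integral>\<^sup>+x. ?g (x,y) \<partial>count_space UNIV \<partial>count_space UNIV)"
    unfolding nn_integral_fst_count_space nn_integral_snd_count_space by (rule refl)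
  also have "\<dots> = (\<integral>\<^sup>+y. \<integral>\<^sup>+x. f x y \<partial>count_space A \<partial>count_space B)"
    by (simp add: nn_integral_count_space_indicator[symmetric] nn_integral_multc
        nn_integral_count_space_indicator mult_ac)
      (auto intro!: nn_integral_cong simp: indicator_def)
  finally show ?thesis .
qed

lemma nn_integral_count_space_shift:
  fixes f :: "int \<Rightarrow> ennreal"
  shows "(\<integral>\<^sup>+k. f (k + m) \<partial>count_space UNIV) = (\<integral>\<^sup>+k. f k \<partial>count_space UNIV)"
  by (rule nn_integral_bij_count_space[of "\<lambda>k. k + m"])
    (auto intro!: bij_betwI[where g = "\<lambda>k. k - m"])

lemma nn_integral_count_space_reflect:
  fixes f :: "int \<Rightarrow> ennreal"
  shows "(\<integral>\<^sup>+k. f (m - k) \<partial>count_space UNIV) = (\<integral>\<^sup>+k. f k \<partial>count_space UNIV)"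
  by (rule nn_integral_bij_count_space[of "\<lambda>k. m - k"])
    (auto intro!: bij_betwI[where g = "\<lambda>k. m - k"])

lemma
  fixes f :: "int \<Rightarrow> 'a :: {comm_monoid_add, t2_space}"
  shows infsum_reflect: "(\<Sum>\<^sub>\<infinity>k. f (m - k)) = infsum f UNIV"
    and summable_on_reflect: "(\<lambda>k. f (m - k)) summable_on UNIV \<longleftrightarrow> f summable_on UNIV"
proof -
  have b: "bij_betw (\<lambda>k::int. m - k) UNIV UNIV"
    by (auto intro!: bij_betwI[where g = "\<lambda>k. m - k"])
  show "(\<Sum>\<^sub>\<infinity>k. f (m - k)) = infsum f UNIV"
    by (rule infsum_reindex_bij_betw[OF b])
  show "(\<lambda>k. f (m - k)) summable_on UNIV \<longleftrightarrow> f summable_on UNIV"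
    by (rule summable_on_reindex_bij_betw[OF b])
qed

text \<open>Convexity of the power function. Dividing by \<open>t\<close> moves the point of
  tangency to 1, where the inequality is Young's inequality for \<open>z powr p\<close> and 1 with
  weights \<open>1/p\<close> and \<open>1 - 1/p\<close>.\<close>

lemma powr_ge_tangent:
  fixes t y p :: real
  assumes "0 < t" "0 \<le> y" "1 \<le> p"
  shows "t powr p + p * t powr (p - 1) * (y - t) \<le> y powr p"
proof (cases "y = 0")
  case True
  have "t powr p = t * t powr (p - 1)" using assms by (simp add: powr_mult_base)
  then have "t powr p + p * t powr (p - 1) * (0 - t) = (1 - p) * t powr p" by (simp add: algebra_simps)
  also have "\<dots> \<le> 0" using assms by (simp add: mult_nonpos_nonneg)
  finally show ?thesis using True assms by simp
next
  case False
  define z where "z = y / t"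
  have z: "z > 0" using False assms by (simp add: z_def)
  have "(z powr p) powr (1/p) * 1 powr (1 - 1/p) \<le> (1/p) * (z powr p) + (1 - 1/p) * 1"
    by (rule Youngs_inequality_0) (use assms z in auto)
  then have "z \<le> (1/p) * (z powr p) + (1 - 1/p)"
    using z assms by (simp add: powr_powr)
  then have "p * z \<le> p * ((1/p) * (z powr p) + (1 - 1/p))"
    using assms by (intro mult_left_mono) auto
  also have "\<dots> = z powr p + p - 1" using assms by (simp add: field_simps)
  finally have zz: "1 + p * (z - 1) \<le> z powr p" by (simp add: algebra_simps)
  have tp: "t powr p = t powr (p - 1) * t" using assms by (simp add: powr_mult_base mult.commute)
  have "t powr p + p * t powr (p - 1) * (y - t) = t powr p * (1 + p * (z - 1))"
    using assms unfolding z_def tp by (simp add: field_simps)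
  also have "\<dots> \<le> t powr p * z powr p" using zz by (intro mult_left_mono) auto
  also have "\<dots> = y powr p" using assms z by (simp add: z_def powr_divide)
  finally show ?thesis .
qed

text \<open>Jensen's inequality for \<open>x \<mapsto> x\<^sup>p\<close>: sum the tangent inequality at the weighted mean.\<close>

lemma infsum_weighted_powr_le:
  fixes u x :: "'a \<Rightarrow> real"
  assumes u: "u summable_on A" "\<And>k. k \<in> A \<Longrightarrow> 0 \<le> u k" "infsum u A \<le> U"
    and x: "\<And>k. k \<in> A \<Longrightarrow> 0 \<le> x k" "\<And>k. k \<in> A \<Longrightarrow> x k \<le> K"
    and p: "1 \<le> p"
  shows "ennreal ((\<Sum>\<^sub>\<infinity>k\<in>A. u k * x k) powr p)
       \<le> ennreal (U powr (p - 1)) * (\<integral>\<^sup>+k. ennreal (u k * x k powr p) \<partial>count_space A)"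
proof -
  have s1: "(\<lambda>k. u k * x k) summable_on A"
    by (rule summable_on_comparison_test[OF summable_on_cmult_left[OF u(1), of K]])
      (use u(2) x in \<open>auto intro!: mult_left_mono\<close>)
  have s2: "(\<lambda>k. u k * x k powr p) summable_on A"
    by (rule summable_on_comparison_test[OF summable_on_cmult_left[OF u(1), of "K powr p"]])
      (use u(2) x p in \<open>auto intro!: mult_left_mono powr_mono2\<close>)
  define T where "T = infsum u A"
  define s where "s = (\<Sum>\<^sub>\<infinity>k\<in>A. u k * x k)"
  have T0: "0 \<le> T" unfolding T_def using u(2) by (rule infsum_nonneg)
  have s0: "0 \<le> s" unfolding s_def using u(2) x(1) by (intro infsum_nonneg) auto
  have i0: "0 \<le> (\<Sum>\<^sub>\<infinity>k\<in>A. u k * x k powr p)" using u(2) by (intro infsum_nonneg) auto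
  have "s powr p \<le> U powr (p - 1) * (\<Sum>\<^sub>\<infinity>k\<in>A. u k * x k powr p)"
  proof (cases "s = 0")
    case True then show ?thesis using p i0 by simp
  next
    case False
    then have s: "s > 0" using s0 by simp
    have "s \<le> T * K"
      unfolding s_def T_def infsum_cmult_left'[symmetric]
      by (intro infsum_mono s1 summable_on_cmult_left u(1)) (use u(2) x in \<open>auto intro!: mult_left_mono\<close>)
    then have T: "T > 0" using s T0 by (cases "T = 0") auto
    define t where "t = s / T"
    have t: "t > 0" using s T by (simp add: t_def)
    have s3: "(\<lambda>k. u k * (t powr p - p * t powr (p-1) * t)) summable_on A"
      by (intro summable_on_cmult_left u(1))
    have s4: "(\<lambda>k. p * t powr (p - 1) * (u k * x k)) summable_on A"
      by (intro summable_on_cmult_right s1)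
    have "T * (t powr p - p * t powr (p-1) * t) + p * t powr (p - 1) * s
       = (\<Sum>\<^sub>\<infinity>k\<in>A. u k * (t powr p - p * t powr (p-1) * t) + p * t powr (p - 1) * (u k * x k))"
      unfolding infsum_add[OF s3 s4] unfolding T_def s_def infsum_cmult_left' infsum_cmult_right' ..
    also have "\<dots> \<le> (\<Sum>\<^sub>\<infinity>k\<in>A. u k * x k powr p)"
    proof (intro infsum_mono summable_on_add s3 s4 s2)
      fix k assume k: "k \<in> A"
      have "u k * (t powr p + p * t powr (p - 1) * (x k - t)) \<le> u k * x k powr p"
        using powr_ge_tangent[OF t x(1)[OF k] p] u(2)[OF k] by (intro mult_left_mono) auto
      then show "u k * (t powr p - p * t powr (p-1) * t) + p * t powr (p - 1) * (u k * x k)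
          \<le> u k * x k powr p" by (simp add: algebra_simps)
    qed
    \<comment> \<open>Since \<open>T * t = s\<close>, the linear parts of the summed tangent
      inequality cancel.\<close>
    finally have *: "T * t powr p \<le> (\<Sum>\<^sub>\<infinity>k\<in>A. u k * x k powr p)"
      using T by (simp add: t_def algebra_simps)
    have "s powr p = T powr p * t powr p" using s T by (simp add: t_def powr_divide)
    also have "T powr p = T powr (p - 1) * T" using T by (simp add: powr_mult_base mult.commute)
    finally have "s powr p = T powr (p - 1) * (T * t powr p)" by simp
    also have "\<dots> \<le> T powr (p - 1) * (\<Sum>\<^sub>\<infinity>k\<in>A. u k * x k powr p)"
      using * by (intro mult_left_mono) auto
    also have "\<dots> \<le> U powr (p - 1) * (\<Sum>\<^sub>\<infinity>k\<in>A. u k * x k powr p)"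
      using T u(3) p i0 by (intro mult_right_mono powr_mono2) (auto simp: T_def)
    finally show ?thesis .
  qed
  then have "ennreal (s powr p) \<le> ennreal (U powr (p - 1) * (\<Sum>\<^sub>\<infinity>k\<in>A. u k * x k powr p))"
    by (rule ennreal_leI)
  also have "\<dots> = ennreal (U powr (p - 1)) * (\<integral>\<^sup>+k. ennreal (u k * x k powr p) \<partial>count_space A)"
    using ennreal_infsum_eq_nn_integral[OF s2] u(2) by (simp add: ennreal_mult' i0)
  finally show ?thesis unfolding s_def .
qed

lemma add_powr_le:
  fixes x y p :: real
  assumes "0 \<le> x" "0 \<le> y" "0 \<le> p"
  shows "(x + y) powr p \<le> 2 powr p * (x powr p + y powr p)"
proof -
  have "(x + y) powr p \<le> (2 * max x y) powr p" using assms by (intro powr_mono2) auto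
  also have "\<dots> = 2 powr p * max x y powr p" using assms by (simp add: powr_mult)
  also have "\<dots> \<le> 2 powr p * (x powr p + y powr p)"
    by (intro mult_left_mono) (auto simp: max_def)
  finally show ?thesis .
qed

section \<open>Matrices with a summable envelope\<close>

text \<open>A trapezoid with plateau of radius \<open>L\<close>, on which coefficients are left
  unchanged, and linear descent to 0 at distance \<open>2 * L\<close>. The slope
  \<open>1 / L\<close> makes commutators small; the plateaus around \<open>m - L\<close> and
  \<open>m + L\<close> together cover the support of the window at \<open>m\<close>.\<close>

definition window :: "int \<Rightarrow> int \<Rightarrow> int \<Rightarrow> real" where
  "window L m k = max 0 (min 1 (2 - \<bar>real_of_int (k - m)\<bar> / real_of_int L))"

lemma window_nonneg: "0 \<le> window L m k"
  and window_le_1: "window L m k \<le> 1"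
  by (auto simp: window_def)

lemma window_eq_1: "L > 0 \<Longrightarrow> \<bar>k - m\<bar> \<le> L \<Longrightarrow> window L m k = 1"
proof -
  assume *: "L > 0" "\<bar>k - m\<bar> \<le> L"
  have "\<bar>real_of_int (k - m)\<bar> / real_of_int L \<le> 1"
    using * by (simp only: of_int_abs[symmetric] divide_le_eq_1 of_int_le_iff) simp
  then show ?thesis by (simp add: window_def)
qed

lemma window_eq_0: "L > 0 \<Longrightarrow> 2 * L < \<bar>k - m\<bar> \<Longrightarrow> window L m k = 0"
proof -
  assume *: "L > 0" "2 * L < \<bar>k - m\<bar>"
  have "2 * real_of_int L \<le> \<bar>real_of_int (k - m)\<bar>"
    using * by linarith
  then have "2 \<le> \<bar>real_of_int (k - m)\<bar> / real_of_int L" using * by (simp add: field_simps)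
  then show ?thesis by (simp add: window_def)
qed

lemma window_lipschitz:
  assumes "L > 0"
  shows "\<bar>window L m k - window L m n\<bar> \<le> min 1 (\<bar>real_of_int (n - k)\<bar> / real_of_int L)"
proof -
  have "\<bar>window L m k - window L m n\<bar>
      \<le> \<bar>\<bar>real_of_int (k - m)\<bar> / real_of_int L - \<bar>real_of_int (n - m)\<bar> / real_of_int L\<bar>"
    unfolding window_def by linarith
  also have "\<dots> = \<bar>\<bar>real_of_int (k - m)\<bar> - \<bar>real_of_int (n - m)\<bar>\<bar> / real_of_int L"
    using assms by (simp add: diff_divide_distrib[symmetric])
  also have "\<dots> \<le> \<bar>real_of_int (n - k)\<bar> / real_of_int L"
    using assms by (intro divide_right_mono) auto
  finally show ?thesis using window_nonneg[of L m] window_le_1[of L m]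
    by (simp add: abs_le_iff) (smt (verit))
qed

text \<open>Rows are indexed by \<open>R\<close>; row \<open>r\<close> is concentrated around the column \<open>pos r\<close>, with an
  \<open>\<ell>\<^sup>1\<close> envelope \<open>\<theta>\<close>.\<close>

locale dominated_matrix =
  fixes R :: "'r set" and pos :: "'r \<Rightarrow> int" and a :: "'r \<Rightarrow> int \<Rightarrow> complex" and \<theta> :: "int \<Rightarrow> real"
  assumes entry_le: "r \<in> R \<Longrightarrow> norm (a r k) \<le> \<theta> (pos r - k)"
    and env_nonneg: "0 \<le> \<theta> n"
    and env_summable: "\<theta> summable_on UNIV"
begin

definition app :: "(int \<Rightarrow> complex) \<Rightarrow> 'r \<Rightarrow> complex" where
  "app c r = (\<Sum>\<^sub>\<infinity>k. c k * a r k)"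

text \<open>A convolution envelope for the commutators with \<open>window L m\<close>, uniform in \<open>m\<close>.\<close>

definition cenv :: "int \<Rightarrow> int \<Rightarrow> real" where
  "cenv L n = \<theta> n * min 1 (\<bar>real_of_int n\<bar> / real_of_int L)"

definition csum :: "int \<Rightarrow> real" where
  "csum L = infsum (cenv L) UNIV"

lemma cenv_nonneg: "L > 0 \<Longrightarrow> 0 \<le> cenv L n"
  unfolding cenv_def by (intro mult_nonneg_nonneg env_nonneg) auto

lemma cenv_le: "L > 0 \<Longrightarrow> cenv L n \<le> \<theta> n"
  unfolding cenv_def using env_nonneg[of n] by (intro mult_left_le) auto

lemma cenv_summable: "L > 0 \<Longrightarrow> cenv L summable_on UNIV"
  by (rule summable_on_comparison_test[OF env_summable]) (auto simp: cenv_nonneg cenv_le)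

lemma csum_nonneg: "L > 0 \<Longrightarrow> 0 \<le> csum L"
  unfolding csum_def by (intro infsum_nonneg cenv_nonneg)

lemma nn_integral_cenv: "L > 0 \<Longrightarrow> (\<integral>\<^sup>+n. ennreal (cenv L n) \<partial>count_space UNIV) = ennreal (csum L)"
  unfolding csum_def by (rule ennreal_infsum_eq_nn_integral[symmetric]) (auto simp: cenv_nonneg cenv_summable)

lemma nn_integral_env: "(\<integral>\<^sup>+n. ennreal (\<theta> n) \<partial>count_space UNIV) = ennreal (infsum \<theta> UNIV)"
  by (rule ennreal_infsum_eq_nn_integral[symmetric]) (auto simp: env_nonneg env_summable)

lemma env_tail:
  assumes "0 < e"
  obtains F where "finite F" "infsum \<theta> UNIV - sum \<theta> F < e"
proof -
  have "(sum \<theta> \<longlongrightarrow> infsum \<theta> UNIV) (finite_subsets_at_top UNIV)"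
    using env_summable by (simp add: has_sum_def[symmetric])
  then have "\<forall>\<^sub>F F in finite_subsets_at_top UNIV. dist (sum \<theta> F) (infsum \<theta> UNIV) < e"
    using assms by (intro tendstoD) auto
  then obtain F where "finite F" "dist (sum \<theta> F) (infsum \<theta> UNIV) < e"
    unfolding eventually_finite_subsets_at_top by blast
  then show ?thesis using that[of F] unfolding dist_real_def by linarith
qed

text \<open>Outside a finite set \<open>F\<close> the envelope has total mass below
  \<open>e / 2\<close>. On \<open>F\<close> the factor is at most \<open>\<bar>n\<bar> / L\<close>,
  so this part is at most \<open>Q / L\<close>, and \<open>L\<close> is taken large against
  \<open>2 * Q / e\<close>.\<close>

lemma csum_small:
  assumes "0 < e"
  obtains L where "L > 0" "csum L < e"
proof -
  obtain F where F: "finite F" "infsum \<theta> UNIV - sum \<theta> F < e / 2"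
    using env_tail[of "e / 2"] assms by auto
  define Q where "Q = (\<Sum>n\<in>F. \<theta> n * \<bar>real_of_int n\<bar>)"
  have Q0: "0 \<le> Q" unfolding Q_def by (intro sum_nonneg mult_nonneg_nonneg env_nonneg) auto
  define L where "L = \<lceil>2 * Q / e\<rceil> + 1"
  have L: "L > 0" unfolding L_def using Q0 assms
    by (smt (verit) divide_nonneg_pos zero_le_ceiling)
  have QL: "Q / real_of_int L < e / 2"
  proof -
    have "2 * Q / e < real_of_int L" unfolding L_def by linarith
    then show ?thesis using L assms by (simp add: field_simps)
  qed
  have split: "infsum f UNIV = sum f F + infsum f (- F)" if "f summable_on UNIV" for f :: "int \<Rightarrow> real"
  proof -
    have "infsum f (F \<union> - F) = infsum f F + infsum f (- F)"
      using that F(1) by (intro infsum_Un_disjoint) (auto intro: summable_on_subset_banach)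
    then show ?thesis using F(1) by simp
  qed
  have "csum L = sum (cenv L) F + infsum (cenv L) (- F)"
    unfolding csum_def by (rule split[OF cenv_summable[OF L]])
  also have "sum (cenv L) F \<le> (\<Sum>n\<in>F. \<theta> n * (\<bar>real_of_int n\<bar> / real_of_int L))"
    unfolding cenv_def by (intro sum_mono mult_left_mono env_nonneg) auto
  also have "\<dots> = Q / real_of_int L" by (simp add: Q_def sum_divide_distrib)
  also have "infsum (cenv L) (- F) \<le> infsum \<theta> (- F)"
    by (intro infsum_mono summable_on_subset_banach[OF cenv_summable[OF L]]
        summable_on_subset_banach[OF env_summable] cenv_le[OF L]) auto
  also have "\<dots> = infsum \<theta> UNIV - sum \<theta> F" using split[OF env_summable] by simp
  also have "\<dots> < e / 2" by (rule F)
  finally have "csum L < e" using QL by linarith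
  then show ?thesis using that L by blast
qed

section \<open>Row sums and commutators with windows\<close>

lemma env_weighted_summable:
  assumes "\<And>k. \<bar>x k\<bar> \<le> K"
  shows "(\<lambda>k. \<theta> (n - k) * x k) summable_on UNIV"
proof -
  have "(\<lambda>k. \<theta> (n - k) * K) summable_on UNIV"
    using env_summable by (intro summable_on_cmult_left) (simp add: summable_on_reflect)
  then have "(\<lambda>k. norm (\<theta> (n - k) * x k)) summable_on UNIV"
    by (rule summable_on_comparison_test)
      (use assms env_nonneg in \<open>auto simp: abs_mult intro!: mult_left_mono\<close>)
  then show ?thesis by (rule abs_summable_summable)
qed

lemma app_abs_summable:
  assumes "\<And>k. norm (c k) \<le> K" "r \<in> R"
  shows "(\<lambda>k. norm (c k * a r k)) summable_on UNIV"
proof (rule summable_on_comparison_test)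
  show "(\<lambda>k. \<theta> (pos r - k) * norm (c k)) summable_on UNIV"
    by (rule env_weighted_summable[of _ K]) (use assms in auto)
  show "norm (c k * a r k) \<le> \<theta> (pos r - k) * norm (c k)" for k
    using entry_le[OF assms(2), of k] by (simp add: norm_mult mult.commute mult_left_mono)
qed auto

lemma norm_app_le:
  assumes "\<And>k. norm (c k) \<le> K" "r \<in> R"
  shows "norm (app c r) \<le> (\<Sum>\<^sub>\<infinity>k. \<theta> (pos r - k) * norm (c k))"
proof -
  have "norm (app c r) \<le> (\<Sum>\<^sub>\<infinity>k. norm (c k * a r k))"
    unfolding app_def by (rule norm_infsum_bound[OF app_abs_summable[OF assms]])
  also have "\<dots> \<le> (\<Sum>\<^sub>\<infinity>k. \<theta> (pos r - k) * norm (c k))"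
    by (intro infsum_mono app_abs_summable[OF assms] env_weighted_summable[of _ K])
      (use assms entry_le in \<open>auto simp: norm_mult mult.commute intro!: mult_left_mono\<close>)
  finally show ?thesis .
qed

text \<open>Bounds the commutator entry in column \<open>k\<close> and a row at position
  \<open>n\<close>. It is kept alongside the convolution bound \<open>cenv\<close> because it
  vanishes when \<open>k\<close> and \<open>n\<close> are both far from \<open>m\<close>, which the
  convolution bound cannot express.\<close>

definition cker :: "int \<Rightarrow> int \<Rightarrow> int \<Rightarrow> int \<Rightarrow> real" where
  "cker L m n k = \<theta> (n - k) * \<bar>window L m k - window L m n\<bar>"

lemma cker_nonneg: "0 \<le> cker L m n k"
  by (simp add: cker_def env_nonneg)

lemma cker_le: "L > 0 \<Longrightarrow> cker L m n k \<le> cenv L (n - k)"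
  unfolding cker_def cenv_def using window_lipschitz[of L m k n] env_nonneg by (intro mult_left_mono)

lemma cker_eq_0: "L > 0 \<Longrightarrow> 2 * L < \<bar>k - m\<bar> \<Longrightarrow> 2 * L < \<bar>n - m\<bar> \<Longrightarrow> cker L m n k = 0"
  by (simp add: cker_def window_eq_0)

lemma cenv_reflect_summable: "L > 0 \<Longrightarrow> (\<lambda>k. cenv L (n - k)) summable_on UNIV"
  using cenv_summable by (simp add: summable_on_reflect)

lemma cker_summable: "L > 0 \<Longrightarrow> cker L m n summable_on UNIV"
  by (rule summable_on_comparison_test[OF cenv_reflect_summable[of L n]]) (auto simp: cker_nonneg cker_le)

lemma cker_sum_le: "L > 0 \<Longrightarrow> infsum (cker L m n) UNIV \<le> csum L"
proof -
  assume L: "L > 0"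
  have "infsum (cker L m n) UNIV \<le> (\<Sum>\<^sub>\<infinity>k. cenv L (n - k))"
    by (intro infsum_mono cker_summable cenv_reflect_summable cker_le L)
  also have "\<dots> = csum L" by (simp add: infsum_reflect csum_def)
  finally show ?thesis .
qed

lemma cker_weighted_summable:
  assumes L: "L > 0" and x: "\<And>k. 0 \<le> x k" "\<And>k. x k \<le> K"
  shows "(\<lambda>k. cker L m n k * x k) summable_on UNIV"
  by (rule summable_on_comparison_test[OF summable_on_cmult_left[OF cker_summable[OF L, of m n], of K]])
    (use x cker_nonneg in \<open>auto intro!: mult_left_mono\<close>)

lemma cker_weighted_sum_le:
  assumes L: "L > 0" and x: "\<And>k. 0 \<le> x k" "\<And>k. x k \<le> K"
  shows "(\<Sum>\<^sub>\<infinity>k. cker L m n k * x k) \<le> csum L * K"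
proof -
  have "(\<Sum>\<^sub>\<infinity>k. cker L m n k * x k) \<le> (\<Sum>\<^sub>\<infinity>k. cker L m n k * K)"
    by (intro infsum_mono cker_weighted_summable[OF L, of _ K] summable_on_cmult_left cker_summable L x)
      (use x cker_nonneg in \<open>auto intro!: mult_left_mono\<close>)
  also have "\<dots> = infsum (cker L m n) UNIV * K" by (simp add: infsum_cmult_left')
  also have "\<dots> \<le> csum L * K"
    using cker_sum_le[OF L] x[of 0] by (intro mult_right_mono) auto
  finally show ?thesis .
qed

lemma windowed_norm_le: "norm (of_real (window L m k) * (c :: complex)) \<le> norm c"
  using window_nonneg[of L m k] window_le_1[of L m k]
  by (simp add: norm_mult mult_left_le_one_le)

text \<open>Freeze the window at the position of the row: the difference has entries
  \<open>a r k\<close> times \<open>window L m k - window L m (pos r)\<close>, and the envelope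
  bounds the first factor.\<close>

lemma commutator_le:
  assumes L: "L > 0" and c: "\<And>k. norm (c k) \<le> K" and r: "r \<in> R"
  shows "norm (app (\<lambda>k. of_real (window L m k) * c k) r)
    \<le> window L m (pos r) * norm (app c r) + (\<Sum>\<^sub>\<infinity>k. cker L m (pos r) k * norm (c k))"
proof -
  let ?w = "\<lambda>k. complex_of_real (window L m k)"
  have c': "norm (?w k * c k) \<le> K" for k using windowed_norm_le c order_trans by blast
  have s1: "(\<lambda>k. (?w k * c k) * a r k) summable_on UNIV"
    by (rule abs_summable_summable[OF app_abs_summable[OF c' r]])
  have s2: "(\<lambda>k. c k * a r k) summable_on UNIV"
    by (rule abs_summable_summable[OF app_abs_summable[OF c r]])
  have s3: "(\<lambda>k. cker L m (pos r) k * norm (c k)) summable_on UNIV"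
    by (rule cker_weighted_summable[OF L, of _ K]) (use c in auto)
  let ?d = "\<lambda>k. (?w k * c k) * a r k + (- ?w (pos r)) * (c k * a r k)"
  have hs: "(?d has_sum (app (\<lambda>k. ?w k * c k) r + (- ?w (pos r)) * app c r)) UNIV"
    unfolding app_def by (intro has_sum_add has_sum_cmult_right has_sum_infsum s1 s2)
  have "norm (app (\<lambda>k. ?w k * c k) r + (- ?w (pos r)) * app c r)
     \<le> (\<Sum>\<^sub>\<infinity>k. cker L m (pos r) k * norm (c k))"
  proof (rule norm_infsum_le[OF hs])
    show "((\<lambda>k. cker L m (pos r) k * norm (c k)) has_sum
       (\<Sum>\<^sub>\<infinity>k. cker L m (pos r) k * norm (c k))) UNIV" by (intro has_sum_infsum s3)
    fix k
    have "?d k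
       = of_real (window L m k - window L m (pos r)) * (c k * a r k)"
      by (simp add: algebra_simps)
    also have "norm \<dots> = \<bar>window L m k - window L m (pos r)\<bar> * norm (c k) * norm (a r k)"
      by (simp only: norm_mult norm_of_real mult.assoc)
    also have "\<dots> \<le> \<bar>window L m k - window L m (pos r)\<bar> * norm (c k) * \<theta> (pos r - k)"
      by (intro mult_left_mono entry_le r) auto
    finally show "norm (?d k) \<le> cker L m (pos r) k * norm (c k)"
      by (simp add: cker_def mult_ac)
  qed
  then have "norm (app (\<lambda>k. ?w k * c k) r) \<le> norm (?w (pos r) * app c r) + (\<Sum>\<^sub>\<infinity>k. cker L m (pos r) k * norm (c k))"
    using norm_triangle_sub[of "app (\<lambda>k. ?w k * c k) r" "?w (pos r) * app c r"] by simp
  then show ?thesis using window_nonneg by (simp add: norm_mult)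
qed

end

section \<open>Absorption and counting over windows\<close>

lemma ennreal_absorb_half:
  fixes x e :: ennreal
  assumes "x \<le> e + ennreal (1/2) * x" "x < top"
  shows "x \<le> 2 * e"
\<comment> \<open>The subtraction is legitimate because \<open>x\<close> is finite;
  \<open>x = top\<close> satisfies the first premise for every \<open>e\<close>.\<close>
proof (cases "e = top")
  case False
  obtain x' where x': "x = ennreal x'" "0 \<le> x'" using assms(2) by (cases x) auto
  obtain e' where e': "e = ennreal e'" "0 \<le> e'" using False by (cases e) auto
  have "ennreal x' \<le> ennreal (e' + 1/2 * x')"
    using assms(1) x' e' by (simp only: ennreal_plus ennreal_mult mult_nonneg_nonneg)
  then have "x' \<le> e' + 1/2 * x'" using x' e' by (subst (asm) ennreal_le_iff) auto
  then have "x' \<le> 2 * e'" by simp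
  then have "ennreal x' \<le> ennreal (2 * e')" by (rule ennreal_leI)
  then show ?thesis using x' e' by (simp add: ennreal_mult)
qed (simp add: ennreal_mult_top)

lemma add3_powr_le:
  fixes x y z p :: real
  assumes "0 \<le> x" "0 \<le> y" "0 \<le> z" "0 \<le> p"
  shows "(x + y + z) powr p \<le> 3 powr p * (x powr p + y powr p + z powr p)"
proof -
  have "(x + y + z) powr p \<le> (3 * max x (max y z)) powr p" using assms by (intro powr_mono2) auto
  also have "\<dots> = 3 powr p * max x (max y z) powr p" using assms by (simp add: powr_mult)
  also have "\<dots> \<le> 3 powr p * (x powr p + y powr p + z powr p)"
    by (intro mult_left_mono) (auto simp: max_def)
  finally show ?thesis .
qed

text \<open>Contains the support of \<open>window L m\<close>. Membership is symmetric in centre and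
  element, which is what makes exchanging sums over windows and over positions easy.\<close>

abbreviation near :: "int \<Rightarrow> int \<Rightarrow> int set" where
  "near L m \<equiv> {m - 2 * L..m + 2 * L}"

lemma near_indicator_commute: "indicator (near L m) k = (indicator (near L k) m :: 'a::zero_neq_one)"
  by (auto simp: indicator_def)

lemma nn_integral_near_const:
  assumes "L > 0"
  shows "(\<integral>\<^sup>+m. y * indicator (near L n) m \<partial>count_space UNIV) = ennreal (4 * real_of_int L + 1) * y"
proof -
  have "(\<integral>\<^sup>+m. y * indicator (near L n) m \<partial>count_space UNIV) = y * emeasure (count_space UNIV) (near L n)"
    by (simp add: nn_integral_cmult_indicator)
  also have "emeasure (count_space UNIV) (near L n) = of_nat (card (near L n))" by simp
  also have "\<dots> = ennreal (4 * real_of_int L + 1)"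
    using assms by (simp add: ennreal_of_nat_eq_real_of_nat algebra_simps)
  finally show ?thesis by (simp add: mult.commute)
qed

text \<open>Each position lies in exactly \<open>4 * L + 1\<close> of the intervals, so adding up
  local norms over all windows gives back the global norm up to this factor.\<close>

lemma nn_integral_near_sum:
  fixes pos :: "'r \<Rightarrow> int"
  assumes "L > 0"
  shows "(\<integral>\<^sup>+m. \<integral>\<^sup>+r. f r * indicator (near L m) (pos r) \<partial>count_space S \<partial>count_space UNIV)
      = ennreal (4 * real_of_int L + 1) * (\<integral>\<^sup>+r. f r \<partial>count_space S)"
proof -
  have "(\<integral>\<^sup>+m. \<integral>\<^sup>+r. f r * indicator (near L m) (pos r) \<partial>count_space S \<partial>count_space UNIV)
     = (\<integral>\<^sup>+r. \<integral>\<^sup>+m. f r * indicator (near L (pos r)) m \<partial>count_space UNIV \<partial>count_space S)"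
    by (subst nn_integral_count_space_swap) (simp add: near_indicator_commute)
  also have "\<dots> = (\<integral>\<^sup>+r. ennreal (4 * real_of_int L + 1) * f r \<partial>count_space S)"
    by (simp add: nn_integral_near_const[OF assms])
  finally show ?thesis by (simp add: nn_integral_cmult)
qed

text \<open>Group the rows by position: each integer is met at most \<nu> times.\<close>

lemma nn_integral_count_space_fiber_le:
  fixes pos :: "'r \<Rightarrow> 'b"
  assumes "\<And>n. finite {r \<in> S. pos r = n}" "\<And>n. card {r \<in> S. pos r = n} \<le> \<nu>"
  shows "(\<integral>\<^sup>+r. f (pos r) \<partial>count_space S) \<le> of_nat \<nu> * (\<integral>\<^sup>+n. f n \<partial>count_space UNIV)"
proof -
  have "f (pos r) = (\<integral>\<^sup>+n. f n * indicator {pos r} n \<partial>count_space UNIV)" for r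
    by (subst nn_integral_count_space'[of "{pos r}"]) auto
  then have "(\<integral>\<^sup>+r. f (pos r) \<partial>count_space S)
      = (\<integral>\<^sup>+r. \<integral>\<^sup>+n. f n * indicator {pos r} n \<partial>count_space UNIV \<partial>count_space S)" by simp
  also have "\<dots> = (\<integral>\<^sup>+n. \<integral>\<^sup>+r. f n * indicator {pos r} n \<partial>count_space S \<partial>count_space UNIV)"
    by (rule nn_integral_count_space_swap)
  also have "\<dots> \<le> (\<integral>\<^sup>+n. of_nat \<nu> * f n \<partial>count_space UNIV)"
  proof (rule nn_integral_mono)
    fix n
    have "(\<integral>\<^sup>+r. f n * indicator {pos r} n \<partial>count_space S)
        = (\<integral>\<^sup>+r. f n * indicator {r \<in> S. pos r = n} r \<partial>count_space S)"
      by (rule nn_integral_cong) (auto simp: indicator_def)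
    also have "\<dots> = f n * emeasure (count_space S) {r \<in> S. pos r = n}"
      by (rule nn_integral_cmult_indicator) simp
    also have "\<dots> = f n * of_nat (card {r \<in> S. pos r = n})"
      using assms(1)[of n] by (subst emeasure_count_space_finite) auto
    also have "\<dots> \<le> f n * of_nat \<nu>" using assms(2)[of n] by (intro mult_left_mono) auto
    finally show "(\<integral>\<^sup>+r. f n * indicator {pos r} n \<partial>count_space S) \<le> of_nat \<nu> * f n"
      by (simp add: mult.commute)
  qed
  also have "\<dots> = of_nat \<nu> * (\<integral>\<^sup>+n. f n \<partial>count_space UNIV)" by (simp add: nn_integral_cmult)
  finally show ?thesis .
qed

lemma nn_integral_convolution_reflect:
  fixes g f :: "int \<Rightarrow> ennreal"
  shows "(\<integral>\<^sup>+k. g (n - k) * f k \<partial>count_space UNIV) = (\<integral>\<^sup>+e. g e * f (n - e) \<partial>count_space UNIV)"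
  using nn_integral_count_space_reflect[of "\<lambda>k. g k * f (n - k)" n] by simp

lemma norm_powr_summable_imp_bounded:
  fixes c :: "int \<Rightarrow> complex"
  assumes "(\<integral>\<^sup>+k. ennreal (norm (c k) powr q) \<partial>count_space UNIV) < top" "0 < q"
  obtains K where "\<And>k. norm (c k) \<le> K"
proof -
  define T where "T = enn2real (\<integral>\<^sup>+k. ennreal (norm (c k) powr q) \<partial>count_space UNIV)"
  have "norm (c k) \<le> T powr (1/q)" for k
  proof -
    have "ennreal (norm (c k) powr q) \<le> (\<integral>\<^sup>+k. ennreal (norm (c k) powr q) \<partial>count_space UNIV)"
      by (rule nn_integral_ge_point) simp
    also have "\<dots> = ennreal T" using assms(1) by (simp add: T_def)
    finally have "norm (c k) powr q \<le> T" by (simp add: T_def)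
    then have "(norm (c k) powr q) powr (1/q) \<le> T powr (1/q)"
      using assms(2) by (intro powr_mono2) auto
    then show ?thesis using assms(2) by (simp add: powr_powr)
  qed
  then show ?thesis by (rule that)
qed

section \<open>Upper bounds, and transfer of lower bounds between exponents\<close>

context dominated_matrix
begin

text \<open>Young's convolution inequality with multiplicity: Jensen with weights \<theta> in each
  row, then summation over rows, at most \<nu> of which share a position.\<close>

lemma app_lp_bounded:
  assumes S: "S \<subseteq> R" and fib: "\<And>n. finite {r \<in> S. pos r = n}" "\<And>n. card {r \<in> S. pos r = n} \<le> \<nu>"
    and p: "1 \<le> p" and c: "\<And>k. norm (c k) \<le> K"
  shows "(\<integral>\<^sup>+r. ennreal (norm (app c r) powr p) \<partial>count_space S)
    \<le> ennreal (infsum \<theta> UNIV powr (p - 1) * \<nu> * infsum \<theta> UNIV)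
        * (\<integral>\<^sup>+k. ennreal (norm (c k) powr p) \<partial>count_space UNIV)"
proof -
  define T where "T = infsum \<theta> UNIV"
  have T0: "0 \<le> T" unfolding T_def by (intro infsum_nonneg env_nonneg)
  have "(\<integral>\<^sup>+r. ennreal (norm (app c r) powr p) \<partial>count_space S)
    \<le> (\<integral>\<^sup>+r. ennreal (T powr (p - 1)) *
          (\<integral>\<^sup>+k. ennreal (\<theta> (pos r - k) * norm (c k) powr p) \<partial>count_space UNIV) \<partial>count_space S)"
  proof (rule nn_integral_mono)
    fix r assume "r \<in> space (count_space S)"
    then have r: "r \<in> R" using S by auto
    have "ennreal (norm (app c r) powr p) \<le> ennreal ((\<Sum>\<^sub>\<infinity>k. \<theta> (pos r - k) * norm (c k)) powr p)"
      using norm_app_le[OF c r] p by (intro ennreal_leI powr_mono2) auto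
    also have "\<dots> \<le> ennreal (T powr (p - 1)) * (\<integral>\<^sup>+k. ennreal (\<theta> (pos r - k) * norm (c k) powr p) \<partial>count_space UNIV)"
      by (rule infsum_weighted_powr_le[where K = K])
        (use env_nonneg env_summable c p in \<open>auto simp: summable_on_reflect infsum_reflect T_def\<close>)
    finally show "ennreal (norm (app c r) powr p) \<le> \<dots>" .
  qed
  also have "\<dots> = ennreal (T powr (p - 1)) * (\<integral>\<^sup>+r.
          (\<integral>\<^sup>+k. ennreal (\<theta> (pos r - k) * norm (c k) powr p) \<partial>count_space UNIV) \<partial>count_space S)"
    by (simp add: nn_integral_cmult)
  also have "\<dots> \<le> ennreal (T powr (p - 1)) * (of_nat \<nu> * (\<integral>\<^sup>+n.
          (\<integral>\<^sup>+k. ennreal (\<theta> (n - k) * norm (c k) powr p) \<partial>count_space UNIV) \<partial>count_space UNIV))"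
    by (intro mult_left_mono nn_integral_count_space_fiber_le[where
          f = "\<lambda>n. (\<integral>\<^sup>+k. ennreal (\<theta> (n - k) * norm (c k) powr p) \<partial>count_space UNIV)"] fib) auto
  also have "(\<integral>\<^sup>+n. (\<integral>\<^sup>+k. ennreal (\<theta> (n - k) * norm (c k) powr p) \<partial>count_space UNIV) \<partial>count_space UNIV)
     = (\<integral>\<^sup>+k. (\<integral>\<^sup>+n. ennreal (\<theta> (n + (- k))) * ennreal (norm (c k) powr p) \<partial>count_space UNIV) \<partial>count_space UNIV)"
    by (subst nn_integral_count_space_swap) (simp add: ennreal_mult env_nonneg)
  also have "\<dots> = (\<integral>\<^sup>+k. ennreal T * ennreal (norm (c k) powr p) \<partial>count_space UNIV)"
    by (subst nn_integral_multc) (auto simp only: nn_integral_count_space_shift[of "\<lambda>n. ennreal (\<theta> n)"] nn_integral_env T_def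
        borel_measurable_count_space)
  also have "\<dots> = ennreal T * (\<integral>\<^sup>+k. ennreal (norm (c k) powr p) \<partial>count_space UNIV)"
    by (simp add: nn_integral_cmult)
  finally show ?thesis using T0
    by (simp add: ennreal_mult mult.assoc ennreal_of_nat_eq_real_of_nat flip: T_def)
qed

text \<open>The hypothesis, applied to windowed coefficients, bounds \<open>c\<close> on the plateau
  around \<open>m\<close> by \<open>C * D m\<close>, where \<open>D m\<close> consists of a local
  l^q norm of the samples and two commutator errors expressed by the local maxima \<alpha> of
  \<open>c\<close>. Taking l^q norms in \<open>m\<close> returns the l^q norm of \<alpha> on the
  right with a factor of at most 1/2.\<close>

lemma sup_stable_imp_lq_stable:
  assumes S: "S \<subseteq> R" and C: "C > 0" and q: "1 \<le> q"
    and H: "\<And>c K D k. (\<forall>k. norm (c k) \<le> K) \<Longrightarrow> 0 \<le> D \<Longrightarrow> (\<forall>r\<in>S. norm (app c r) \<le> D) \<Longrightarrow> norm (c k) \<le> C * D"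
  shows "\<exists>C'>0. \<forall>c. (\<integral>\<^sup>+k. ennreal (norm (c k) powr q) \<partial>count_space UNIV) < top \<longrightarrow>
     (\<integral>\<^sup>+k. ennreal (norm (c k) powr q) \<partial>count_space UNIV)
       \<le> ennreal C' * (\<integral>\<^sup>+r. ennreal (norm (app c r) powr q) \<partial>count_space S)"
proof -
  \<comment> \<open>This choice gives \<open>(3 * C * \<eta>) powr q \<le> 1/8\<close>. The 3 stems
    from splitting \<open>D m\<close> into three terms; two plateaus and two error terms later
    contribute a factor 4, leaving 1/2.\<close>
  define e where "e = (1/8) powr (1/q) / (3 * C)"
  have "e > 0" using C by (simp add: e_def)
  then obtain L where L: "L > 0" "csum L < e" by (rule csum_small)
  define \<eta> where "\<eta> = csum L"
  have \<eta>: "0 \<le> \<eta>" unfolding \<eta>_def by (rule csum_nonneg[OF L(1)])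
  have small: "4 * ((3 * C) powr q * \<eta> powr q) \<le> 1/2"
  proof -
    have "(3 * C) powr q * \<eta> powr q = (3 * C * \<eta>) powr q" using C \<eta> by (simp add: powr_mult)
    also have "\<dots> \<le> ((1/8) powr (1/q)) powr q"
      using L(2) C q \<eta> by (intro powr_mono2) (auto simp: \<eta>_def e_def field_simps)
    also have "\<dots> = 1/8" using q by (simp add: powr_powr)
    finally show ?thesis by simp
  qed
  \<comment> \<open>One factor 2 comes from the two plateaus, one from the absorption, and
    \<open>4 * L + 1\<close> from summing over windows.\<close>
  define C' where "C' = 4 * ((3 * C) powr q * (4 * real_of_int L + 1))"
  have C': "C' > 0" unfolding C'_def using C L(1) by (intro mult_pos_pos) auto
  have main: "(\<integral>\<^sup>+k. ennreal (norm (c k) powr q) \<partial>count_space UNIV)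
       \<le> ennreal C' * (\<integral>\<^sup>+r. ennreal (norm (app c r) powr q) \<partial>count_space S)"
    if cfin: "(\<integral>\<^sup>+k. ennreal (norm (c k) powr q) \<partial>count_space UNIV) < top"
      and Tfin: "(\<integral>\<^sup>+r. ennreal (norm (app c r) powr q) \<partial>count_space S) < top" for c
  proof -
    obtain K where K: "\<And>k. norm (c k) \<le> K"
      using norm_powr_summable_imp_bounded[OF cfin] q by auto
    define \<alpha> where "\<alpha> m = Max ((\<lambda>k. norm (c k)) ` near L m)" for m
    have ne: "near L m \<noteq> {}" for m using L(1) by auto
    have \<alpha>ge: "norm (c k) \<le> \<alpha> m" if "k \<in> near L m" for k m
      unfolding \<alpha>_def using that by (intro Max_ge) auto
    have \<alpha>att: "\<exists>k\<in>near L m. \<alpha> m = norm (c k)" for m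
    proof -
      have "\<alpha> m \<in> (\<lambda>k. norm (c k)) ` near L m"
        unfolding \<alpha>_def using ne[of m] by (intro Max_in) auto
      then show ?thesis by blast
    qed
    have \<alpha>0: "0 \<le> \<alpha> m" for m using \<alpha>att[of m] by auto
    have \<alpha>K: "\<alpha> m \<le> K" for m using \<alpha>att[of m] K by auto
    define b where "b m = (\<integral>\<^sup>+r. ennreal (norm (app c r) powr q) * indicator (near L m) (pos r) \<partial>count_space S)" for m
    have bfin: "b m < top" for m
    proof -
      have "b m \<le> (\<integral>\<^sup>+r. ennreal (norm (app c r) powr q) \<partial>count_space S)"
        unfolding b_def by (intro nn_integral_mono) (auto simp: indicator_def)
      then show ?thesis using Tfin by simp
    qed
    define \<beta> where "\<beta> m = enn2real (b m) powr (1/q)" for m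
    have \<beta>0: "0 \<le> \<beta> m" for m by (simp add: \<beta>_def)
    have \<beta>q: "ennreal (\<beta> m powr q) = b m" for m
      using bfin[of m] q by (simp add: \<beta>_def powr_powr)
    have \<beta>ge: "norm (app c r) \<le> \<beta> m" if "r \<in> S" "pos r \<in> near L m" for r m
    proof -
      have "ennreal (norm (app c r) powr q) * indicator (near L m) (pos r) \<le> b m"
        unfolding b_def using that(1) by (rule nn_integral_ge_point)
      then have "ennreal (norm (app c r) powr q) \<le> ennreal (enn2real (b m))"
        using that(2) bfin[of m] by simp
      then have "norm (app c r) powr q \<le> enn2real (b m)" by simp
      then have "(norm (app c r) powr q) powr (1/q) \<le> \<beta> m"
        unfolding \<beta>_def using q by (intro powr_mono2) auto
      then show ?thesis using q by (simp add: powr_powr)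
    qed
    define \<zeta> where "\<zeta> m = (\<Sum>\<^sub>\<infinity>e. cenv L e * \<alpha> (m - e))" for m
    have \<zeta>summ: "(\<lambda>e. cenv L e * \<alpha> (m - e)) summable_on UNIV" for m
      by (rule summable_on_comparison_test[OF summable_on_cmult_left[OF cenv_summable[OF L(1)], of K]])
        (use \<alpha>0 \<alpha>K cenv_nonneg[OF L(1)] in \<open>auto intro!: mult_left_mono\<close>)
    have \<zeta>0: "0 \<le> \<zeta> m" for m
      unfolding \<zeta>_def using \<alpha>0 cenv_nonneg[OF L(1)] by (intro infsum_nonneg) auto
    define D where "D m = \<beta> m + \<eta> * \<alpha> m + \<zeta> m" for m
    have D0: "0 \<le> D m" for m using \<alpha>0 \<beta>0 \<zeta>0 \<eta> by (simp add: D_def)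
    \<comment> \<open>A row near \<open>m\<close> sees columns at every distance: with
      \<open>e = n - k\<close>, the column \<open>n - e\<close> lies near \<open>m - e\<close>,
      where \<open>c\<close> is at most \<open>\<alpha> (m - e)\<close>, which gives \<zeta>. A row
      far from \<open>m\<close> has nonzero kernel only in columns near \<open>m\<close>, which
      gives \<open>\<eta> * \<alpha> m\<close>.\<close>
    have comm: "(\<Sum>\<^sub>\<infinity>k. cker L m n k * norm (c k)) \<le> \<eta> * \<alpha> m + \<zeta> m" for m n
    proof (cases "n \<in> near L m")
      case True
      have r1: "(\<lambda>k. cenv L (n - k) * norm (c (n - (n - k)))) summable_on UNIV"
      proof (rule summable_on_comparison_test[OF summable_on_cmult_left[OF cenv_reflect_summable[OF L(1), of n], of K]])
        show "cenv L (n - k) * norm (c (n - (n - k))) \<le> cenv L (n - k) * K" for k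
          using K[of k] cenv_nonneg[OF L(1)] by (simp add: mult_left_mono)
        show "0 \<le> cenv L (n - k) * norm (c (n - (n - k)))" for k
          using cenv_nonneg[OF L(1)] by simp
      qed
      have "(\<Sum>\<^sub>\<infinity>k. cker L m n k * norm (c k)) \<le> (\<Sum>\<^sub>\<infinity>k. cenv L (n - k) * norm (c (n - (n - k))))"
        using K cker_le[OF L(1)] by (intro infsum_mono cker_weighted_summable[OF L(1), of _ K] r1)
            (auto intro!: mult_right_mono)
      also have "\<dots> = (\<Sum>\<^sub>\<infinity>e. cenv L e * norm (c (n - e)))"
        by (rule infsum_reflect[of "\<lambda>e. cenv L e * norm (c (n - e))"])
      also have "\<dots> \<le> \<zeta> m"
        unfolding \<zeta>_def
      proof (intro infsum_mono \<zeta>summ)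
        show "(\<lambda>e. cenv L e * norm (c (n - e))) summable_on UNIV"
          using r1 by (simp only: summable_on_reflect[of "\<lambda>e. cenv L e * norm (c (n - e))"])
        show "cenv L e * norm (c (n - e)) \<le> cenv L e * \<alpha> (m - e)" for e
          using True by (intro mult_left_mono \<alpha>ge cenv_nonneg[OF L(1)]) auto
      qed
      finally show ?thesis using \<eta> \<alpha>0[of m] by (smt (verit) mult_nonneg_nonneg)
    next
      case False
      have "(\<Sum>\<^sub>\<infinity>k. cker L m n k * norm (c k)) \<le> (\<Sum>\<^sub>\<infinity>k. cker L m n k * \<alpha> m)"
      proof (intro infsum_mono cker_weighted_summable[OF L(1), of _ K] summable_on_cmult_left cker_summable L(1) K)
        fix k
        show "cker L m n k * norm (c k) \<le> cker L m n k * \<alpha> m"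
        proof (cases "k \<in> near L m")
          case True then show ?thesis by (intro mult_left_mono \<alpha>ge cker_nonneg)
        next
          case F: False
          have "cker L m n k = 0" using False F by (intro cker_eq_0 L(1)) auto
          then show ?thesis by simp
        qed
      qed (use \<alpha>0 \<alpha>K in auto)
      also have "\<dots> = infsum (cker L m n) UNIV * \<alpha> m" by (simp add: infsum_cmult_left')
      also have "\<dots> \<le> \<eta> * \<alpha> m"
        using cker_sum_le[OF L(1)] \<alpha>0 by (intro mult_right_mono) (auto simp: \<eta>_def)
      finally show ?thesis using \<zeta>0[of m] by simp
    qed
    have cD: "norm (c k) \<le> C * D m" if "\<bar>k - m\<bar> \<le> L" for k m
    proof -
      let ?c = "\<lambda>k. of_real (window L m k) * c k"
      have "norm (?c k) \<le> C * D m"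
      proof (rule H[of ?c K])
        show "\<forall>k. norm (?c k) \<le> K" using windowed_norm_le K order_trans by blast
        show "0 \<le> D m" by (rule D0)
        show "\<forall>r\<in>S. norm (app ?c r) \<le> D m"
        proof
          fix r assume r: "r \<in> S"
          have "window L m (pos r) * norm (app c r) \<le> \<beta> m"
          proof (cases "pos r \<in> near L m")
            case True
            have "window L m (pos r) * norm (app c r) \<le> 1 * norm (app c r)"
              by (intro mult_right_mono window_le_1) auto
            then show ?thesis using \<beta>ge[OF r True] by simp
          next
            case False
            then have "window L m (pos r) = 0" by (intro window_eq_0 L(1)) auto
            then show ?thesis using \<beta>0 by simp
          qed
          then show "norm (app ?c r) \<le> D m"
            using commutator_le[where m = m and L = L and c = c and K = K and r = r] comm[of m "pos r"] r S L(1) K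
            unfolding D_def by fastforce
        qed
      qed
      then show ?thesis using window_eq_1[OF L(1) that] by simp
    qed
    \<comment> \<open>The point where the maximum is attained lies on one of the two plateaus around
      \<open>m - L\<close> and \<open>m + L\<close>.\<close>
    have \<alpha>D: "\<alpha> m powr q \<le> (C * D (m - L)) powr q + (C * D (m + L)) powr q" for m
    proof -
      obtain k where k: "k \<in> near L m" "\<alpha> m = norm (c k)" using \<alpha>att by blast
      have "\<bar>k - (m - L)\<bar> \<le> L \<or> \<bar>k - (m + L)\<bar> \<le> L" using k(1) by auto
      then have "\<alpha> m \<le> C * D (m - L) \<or> \<alpha> m \<le> C * D (m + L)" using cD k(2) by auto
      then have "\<alpha> m powr q \<le> (C * D (m - L)) powr q \<or> \<alpha> m powr q \<le> (C * D (m + L)) powr q"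
        using \<alpha>0 q by (auto intro: powr_mono2)
      then show ?thesis by (smt (verit) powr_ge_zero)
    qed
    define X where "X = (\<integral>\<^sup>+m. ennreal (\<alpha> m powr q) \<partial>count_space UNIV)"
    \<comment> \<open>Needed for the absorption: a maximum over \<open>near L m\<close> is at most
      the sum there, so finiteness comes from \<open>c\<close> being in l^q.\<close>
    have Xfin: "X < top"
    proof -
      have "X \<le> (\<integral>\<^sup>+m. \<integral>\<^sup>+k. ennreal (norm (c k) powr q) * indicator (near L m) k \<partial>count_space UNIV \<partial>count_space UNIV)"
        unfolding X_def
      proof (rule nn_integral_mono)
        fix m
        obtain k where k: "k \<in> near L m" "\<alpha> m = norm (c k)" using \<alpha>att by blast
        then have "ennreal (\<alpha> m powr q) = ennreal (norm (c k) powr q) * indicator (near L m) k" by simp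
        also have "\<dots> \<le> (\<integral>\<^sup>+k. ennreal (norm (c k) powr q) * indicator (near L m) k \<partial>count_space UNIV)"
          by (rule nn_integral_ge_point) simp
        finally show "ennreal (\<alpha> m powr q) \<le> \<dots>" .
      qed
      also have "\<dots> = ennreal (4 * real_of_int L + 1) * (\<integral>\<^sup>+k. ennreal (norm (c k) powr q) \<partial>count_space UNIV)"
        by (rule nn_integral_near_sum[OF L(1)])
      also have "\<dots> < top" using cfin by (simp add: ennreal_mult_less_top)
      finally show ?thesis .
    qed
    \<comment> \<open>Young's inequality for the convolution of \<open>cenv L\<close>, of mass
      \<eta>, with \<alpha>.\<close>
    have \<zeta>X: "(\<integral>\<^sup>+m. ennreal (\<zeta> m powr q) \<partial>count_space UNIV) \<le> ennreal (\<eta> powr q) * X"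
    proof -
      have "(\<integral>\<^sup>+m. ennreal (\<zeta> m powr q) \<partial>count_space UNIV)
        \<le> (\<integral>\<^sup>+m. ennreal (\<eta> powr (q - 1)) * (\<integral>\<^sup>+e. ennreal (cenv L e * \<alpha> (m - e) powr q) \<partial>count_space UNIV) \<partial>count_space UNIV)"
        unfolding \<zeta>_def using cenv_summable[OF L(1)] cenv_nonneg[OF L(1)] \<alpha>0 \<alpha>K q
        by (intro nn_integral_mono infsum_weighted_powr_le[where K = K]) (auto simp: \<eta>_def csum_def)
      also have "\<dots> = ennreal (\<eta> powr (q - 1)) * (\<integral>\<^sup>+m. (\<integral>\<^sup>+e. ennreal (cenv L e * \<alpha> (m - e) powr q) \<partial>count_space UNIV) \<partial>count_space UNIV)"
        by (simp add: nn_integral_cmult)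
      also have "(\<integral>\<^sup>+m. (\<integral>\<^sup>+e. ennreal (cenv L e * \<alpha> (m - e) powr q) \<partial>count_space UNIV) \<partial>count_space UNIV)
        = (\<integral>\<^sup>+e. (\<integral>\<^sup>+m. ennreal (cenv L e) * ennreal (\<alpha> (m + (- e)) powr q) \<partial>count_space UNIV) \<partial>count_space UNIV)"
        by (subst nn_integral_count_space_swap) (simp add: ennreal_mult cenv_nonneg[OF L(1)])
      also have "\<dots> = (\<integral>\<^sup>+e. ennreal (cenv L e) * X \<partial>count_space UNIV)"
        unfolding X_def
        by (subst nn_integral_cmult) (auto simp only: nn_integral_count_space_shift[of "\<lambda>m. ennreal (\<alpha> m powr q)"] borel_measurable_count_space)
      also have "\<dots> = ennreal \<eta> * X"
        by (simp add: nn_integral_multc nn_integral_cenv[OF L(1)] \<eta>_def)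
      also have "ennreal (\<eta> powr (q - 1)) * (ennreal \<eta> * X) = ennreal (\<eta> powr q) * X"
      proof -
        have "\<eta> powr q = \<eta> powr (q - 1) * \<eta>"
          using \<eta> q by (cases "\<eta> = 0") (auto simp: powr_mult_base mult.commute)
        then show ?thesis using \<eta> by (simp add: ennreal_mult mult.assoc)
      qed
      finally show ?thesis .
    qed
    have DX: "(\<integral>\<^sup>+m. ennreal ((C * D m) powr q) \<partial>count_space UNIV)
      \<le> ennreal ((3 * C) powr q) * ((\<integral>\<^sup>+m. b m \<partial>count_space UNIV) + ennreal (\<eta> powr q) * X + ennreal (\<eta> powr q) * X)"
    proof -
      have "(\<integral>\<^sup>+m. ennreal ((C * D m) powr q) \<partial>count_space UNIV)
        \<le> (\<integral>\<^sup>+m. ennreal ((3 * C) powr q) * (b m + ennreal (\<eta> powr q) * ennreal (\<alpha> m powr q) + ennreal (\<zeta> m powr q)) \<partial>count_space UNIV)"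
      proof (rule nn_integral_mono)
        fix m
        have "(C * D m) powr q = C powr q * D m powr q" using C D0 by (simp add: powr_mult)
        also have "D m powr q \<le> 3 powr q * (\<beta> m powr q + (\<eta> * \<alpha> m) powr q + \<zeta> m powr q)"
          unfolding D_def using \<beta>0 \<eta> \<alpha>0 \<zeta>0 q by (intro add3_powr_le) auto
        finally have "(C * D m) powr q \<le> (3 * C) powr q * (\<beta> m powr q + \<eta> powr q * \<alpha> m powr q + \<zeta> m powr q)"
          using C \<eta> \<alpha>0 by (simp add: powr_mult mult_ac)
        then have "ennreal ((C * D m) powr q) \<le> ennreal ((3 * C) powr q * (\<beta> m powr q + \<eta> powr q * \<alpha> m powr q + \<zeta> m powr q))"
          by (rule ennreal_leI)
        also have "\<dots> = ennreal ((3 * C) powr q) * (b m + ennreal (\<eta> powr q) * ennreal (\<alpha> m powr q) + ennreal (\<zeta> m powr q))"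
          by (simp add: ennreal_mult flip: \<beta>q)
        finally show "ennreal ((C * D m) powr q) \<le> \<dots>" .
      qed
      also have "\<dots> = ennreal ((3 * C) powr q) * ((\<integral>\<^sup>+m. b m \<partial>count_space UNIV) + ennreal (\<eta> powr q) * X
            + (\<integral>\<^sup>+m. ennreal (\<zeta> m powr q) \<partial>count_space UNIV))"
        by (simp add: nn_integral_cmult nn_integral_add X_def)
      also have "\<dots> \<le> ennreal ((3 * C) powr q) * ((\<integral>\<^sup>+m. b m \<partial>count_space UNIV) + ennreal (\<eta> powr q) * X + ennreal (\<eta> powr q) * X)"
        by (intro mult_left_mono add_left_mono \<zeta>X) auto
      finally show ?thesis .
    qed
    define Y where "Y = (\<integral>\<^sup>+m. ennreal ((C * D m) powr q) \<partial>count_space UNIV)"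
    define B where "B = (\<integral>\<^sup>+m. b m \<partial>count_space UNIV)"
    have "X \<le> (\<integral>\<^sup>+m. ennreal ((C * D (m + (- L))) powr q) + ennreal ((C * D (m + L)) powr q) \<partial>count_space UNIV)"
      unfolding X_def using \<alpha>D by (intro nn_integral_mono) (simp add: ennreal_leI flip: ennreal_plus)
    also have "\<dots> = Y + Y"
      unfolding Y_def
      by (subst nn_integral_add) (auto simp only: nn_integral_count_space_shift[of "\<lambda>m. ennreal ((C * D m) powr q)"] borel_measurable_count_space)
    also have "\<dots> = 2 * Y" by (simp add: mult_2)
    also have "\<dots> \<le> 2 * (ennreal ((3 * C) powr q) * (B + ennreal (\<eta> powr q) * X + ennreal (\<eta> powr q) * X))"
      using DX by (intro mult_left_mono) (auto simp: Y_def B_def)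
    also have "\<dots> = 2 * (ennreal ((3 * C) powr q) * B) + 4 * (ennreal ((3 * C) powr q) * ennreal (\<eta> powr q)) * X"
    proof -
      have *: "2 * (u * (B + v * x + v * x)) = 2 * (u * B) + 4 * (u * v) * x" for u v x :: ennreal
      proof -
        have "v * x + v * x = 2 * (v * x)" by (simp add: mult_2)
        then have "2 * (u * (B + v * x + v * x)) = 2 * (u * (B + 2 * (v * x)))" by (simp add: add.assoc)
        also have "\<dots> = 2 * (u * B) + (2 * 2) * (u * v) * x" by (simp only: distrib_left mult_ac)
        finally show ?thesis by simp
      qed
      show ?thesis by (rule *)
    qed
    also have "4 * (ennreal ((3 * C) powr q) * ennreal (\<eta> powr q)) = ennreal (4 * ((3 * C) powr q * \<eta> powr q))"
      by (simp add: ennreal_mult)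
    also have "2 * (ennreal ((3 * C) powr q) * B) + ennreal (4 * ((3 * C) powr q * \<eta> powr q)) * X
       \<le> 2 * (ennreal ((3 * C) powr q) * B) + ennreal (1/2) * X"
      using small by (intro add_left_mono mult_right_mono ennreal_leI) auto
    finally have "X \<le> 2 * (2 * (ennreal ((3 * C) powr q) * B))" using Xfin by (rule ennreal_absorb_half)
    also have "B = ennreal (4 * real_of_int L + 1) * (\<integral>\<^sup>+r. ennreal (norm (app c r) powr q) \<partial>count_space S)"
      unfolding B_def b_def by (rule nn_integral_near_sum[OF L(1)])
    also have "2 * (2 * (ennreal ((3 * C) powr q) * (ennreal (4 * real_of_int L + 1) * (\<integral>\<^sup>+r. ennreal (norm (app c r) powr q) \<partial>count_space S))))
       = ennreal C' * (\<integral>\<^sup>+r. ennreal (norm (app c r) powr q) \<partial>count_space S)"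
    proof -
      have "ennreal C' = 2 * 2 * (ennreal ((3 * C) powr q) * ennreal (4 * real_of_int L + 1))"
        using L(1) by (simp add: C'_def ennreal_mult)
      then show ?thesis by (simp only: mult_ac)
    qed
    finally have "X \<le> ennreal C' * (\<integral>\<^sup>+r. ennreal (norm (app c r) powr q) \<partial>count_space S)" .
    moreover have "(\<integral>\<^sup>+k. ennreal (norm (c k) powr q) \<partial>count_space UNIV) \<le> X"
      unfolding X_def using L(1) q by (intro nn_integral_mono ennreal_leI powr_mono2 \<alpha>ge) auto
    ultimately show ?thesis by simp
  qed
  show ?thesis
  proof (intro exI conjI allI impI)
    fix c :: "int \<Rightarrow> complex" assume cfin: "(\<integral>\<^sup>+k. ennreal (norm (c k) powr q) \<partial>count_space UNIV) < top"
    show "(\<integral>\<^sup>+k. ennreal (norm (c k) powr q) \<partial>count_space UNIV)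
       \<le> ennreal C' * (\<integral>\<^sup>+r. ennreal (norm (app c r) powr q) \<partial>count_space S)"
    proof (cases "(\<integral>\<^sup>+r. ennreal (norm (app c r) powr q) \<partial>count_space S) = top")
      case True
      then show ?thesis using C' by (simp add: ennreal_mult_top)
    qed (use main cfin in \<open>simp add: less_top\<close>)
  qed (rule C')
qed

text \<open>For bounded \<open>c\<close> the supremum \<open>M\<close> of the local sums
  \<open>W m\<close> is finite even if \<open>c\<close> is in no l^p. Windowed coefficients have
  finite support, so it is enough to have the l^p bound there; it controls \<open>W m\<close> by a
  multiple of \<open>D powr p\<close> plus half of \<open>M\<close>, and the supremum over
  \<open>m\<close> absorbs \<open>M\<close>.\<close>

lemma lp_stable_imp_sup_stable:
  assumes S: "S \<subseteq> R" and fib: "\<And>n. finite {r \<in> S. pos r = n}" "\<And>n. card {r \<in> S. pos r = n} \<le> \<nu>"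
    and C: "C > 0" and p: "1 \<le> p"
    and H: "\<And>c. finite {k. c k \<noteq> 0} \<Longrightarrow> (\<integral>\<^sup>+k. ennreal (norm (c k) powr p) \<partial>count_space UNIV)
       \<le> ennreal C * (\<integral>\<^sup>+r. ennreal (norm (app c r) powr p) \<partial>count_space S)"
  shows "\<exists>C'>0. \<forall>c K D k. (\<forall>k. norm (c k) \<le> K) \<longrightarrow> 0 \<le> D \<longrightarrow> (\<forall>r\<in>S. norm (app c r) \<le> D) \<longrightarrow> norm (c k) \<le> C' * D"
proof -
  \<comment> \<open>The factor \<open>2 powr p\<close> pays for separating the sample term from the
    commutator term.\<close>
  define P where "P = C * 2 powr p"
  have P: "P > 0" using C by (simp add: P_def)
  \<comment> \<open>Makes \<open>4 * P * \<nu> * \<eta> powr p\<close> at most 1/2; the 4 combines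
    the two plateaus with the two parts of the kernel estimate \<open>Z\<close>. Using
    \<open>\<nu> + 1\<close> keeps the denominator positive if there are no rows.\<close>
  define e where "e = (1 / (8 * P * (real \<nu> + 1))) powr (1/p)"
  have "e > 0" using P by (simp add: e_def)
  then obtain L where L: "L > 0" "csum L < e" by (rule csum_small)
  define \<eta> where "\<eta> = csum L"
  have \<eta>: "0 \<le> \<eta>" unfolding \<eta>_def by (rule csum_nonneg[OF L(1)])
  have small: "4 * P * \<nu> * \<eta> powr p \<le> 1/2"
  proof -
    have "\<eta> powr p \<le> e powr p" using \<eta> L(2) p by (intro powr_mono2) (auto simp: \<eta>_def)
    also have "\<dots> = 1 / (8 * P * (real \<nu> + 1))" using p P by (simp add: e_def powr_powr)
    finally have "4 * P * \<nu> * \<eta> powr p \<le> 4 * P * \<nu> * (1 / (8 * P * (real \<nu> + 1)))"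
      using P by (intro mult_left_mono) auto
    also have "\<dots> = (4 * P) * real \<nu> / ((4 * P) * (2 * (real \<nu> + 1)))" by (simp only: mult.assoc times_divide_eq_right mult_1_right)
    also have "\<dots> = real \<nu> / (2 * (real \<nu> + 1))" using P by (intro mult_divide_mult_cancel_left) simp
    also have "\<dots> \<le> 1/2" by (simp add: field_simps)
    finally show ?thesis .
  qed
  define E where "E = 4 * P * (\<nu> + 1) * (4 * real_of_int L + 1)"
  have E: "E > 0" unfolding E_def using P L(1) by (intro mult_pos_pos) auto
  define C' where "C' = E powr (1/p)"
  have C': "C' > 0" using E by (simp add: C'_def)
  have "norm (c k0) \<le> C' * D" if K: "\<And>k. norm (c k) \<le> K" and D: "0 \<le> D"
    and cD: "\<And>r. r \<in> S \<Longrightarrow> norm (app c r) \<le> D" for c K D k0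
  proof -
    define f where "f k = ennreal (norm (c k) powr p)" for k
    define W where "W m = (\<integral>\<^sup>+k. f k * indicator (near L m) k \<partial>count_space UNIV)" for m
    define M where "M = (SUP m. W m)"
    have WM: "W m \<le> M" for m unfolding M_def by (rule SUP_upper) simp
    have Mfin: "M < top"
    proof -
      have "W m \<le> ennreal (4 * real_of_int L + 1) * ennreal (K powr p)" for m
      proof -
        have "W m \<le> (\<integral>\<^sup>+k. ennreal (K powr p) * indicator (near L m) k \<partial>count_space UNIV)"
          unfolding W_def f_def using K p by (intro nn_integral_mono mult_right_mono ennreal_leI powr_mono2) auto
        then show ?thesis by (simp add: nn_integral_near_const[OF L(1)])
      qed
      then have "M \<le> ennreal (4 * real_of_int L + 1) * ennreal (K powr p)"
        unfolding M_def by (intro SUP_least)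
      also have "\<dots> < top" by (simp add: ennreal_mult_less_top)
      finally show ?thesis .
    qed
    define V where "V m = (\<integral>\<^sup>+k. f k * indicator {m - L..m + L} k \<partial>count_space UNIV)" for m
    define Z where "Z m n = (\<integral>\<^sup>+k. ennreal (cker L m n k * norm (c k) powr p) \<partial>count_space UNIV)" for m n
    \<comment> \<open>The kernel is nonzero only if the column or the row is near \<open>m\<close>.
      In the first case summing over rows first gives \<open>\<eta> * W m\<close>; in the second,
      summing along the diagonals \<open>n - k = e\<close> gives an average of the shifted local
      sums \<open>W (m - e)\<close>. Both are at most \<open>\<eta> * M\<close>.\<close>
    have Z: "(\<integral>\<^sup>+n. Z m n \<partial>count_space UNIV) \<le> 2 * (ennreal \<eta> * M)" for m
    proof -
      have "(\<integral>\<^sup>+n. Z m n \<partial>count_space UNIV)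
        \<le> (\<integral>\<^sup>+n. \<integral>\<^sup>+k. ennreal (cenv L (n - k)) * (f k * indicator (near L m) k)
              + ennreal (cenv L (n - k)) * f k * indicator (near L m) n \<partial>count_space UNIV \<partial>count_space UNIV)"
        unfolding Z_def
      proof (intro nn_integral_mono)
        fix n k
        show "ennreal (cker L m n k * norm (c k) powr p) \<le> ennreal (cenv L (n - k)) * (f k * indicator (near L m) k)
              + ennreal (cenv L (n - k)) * f k * indicator (near L m) n"
        proof (cases "k \<in> near L m \<or> n \<in> near L m")
          case True
          have "ennreal (cker L m n k * norm (c k) powr p) \<le> ennreal (cenv L (n - k) * norm (c k) powr p)"
            by (intro ennreal_leI mult_right_mono cker_le[OF L(1)]) auto
          also have "\<dots> = ennreal (cenv L (n - k)) * f k"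
            by (simp add: f_def ennreal_mult cenv_nonneg[OF L(1)])
          also have "\<dots> \<le> ennreal (cenv L (n - k)) * (f k * indicator (near L m) k)
              + ennreal (cenv L (n - k)) * f k * indicator (near L m) n"
            using True by (auto simp: indicator_def)
          finally show ?thesis .
        next
          case False
          then have "cker L m n k = 0" by (intro cker_eq_0 L(1)) auto
          then show ?thesis by simp
        qed
      qed
      also have "\<dots> = (\<integral>\<^sup>+n. \<integral>\<^sup>+k. ennreal (cenv L (n - k)) * (f k * indicator (near L m) k) \<partial>count_space UNIV \<partial>count_space UNIV)
         + (\<integral>\<^sup>+n. (\<integral>\<^sup>+k. ennreal (cenv L (n - k)) * f k \<partial>count_space UNIV) * indicator (near L m) n \<partial>count_space UNIV)"
        by (simp add: nn_integral_add nn_integral_multc)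
      also have "(\<integral>\<^sup>+n. \<integral>\<^sup>+k. ennreal (cenv L (n - k)) * (f k * indicator (near L m) k) \<partial>count_space UNIV \<partial>count_space UNIV)
         = (\<integral>\<^sup>+k. \<integral>\<^sup>+n. ennreal (cenv L (n + (- k))) * (f k * indicator (near L m) k) \<partial>count_space UNIV \<partial>count_space UNIV)"
        by (subst nn_integral_count_space_swap) simp
      also have "\<dots> = (\<integral>\<^sup>+k. ennreal \<eta> * (f k * indicator (near L m) k) \<partial>count_space UNIV)"
        by (subst nn_integral_multc) (auto simp only: nn_integral_count_space_shift[of "\<lambda>n. ennreal (cenv L n)"]
            nn_integral_cenv[OF L(1)] \<eta>_def borel_measurable_count_space)
      also have "\<dots> = ennreal \<eta> * W m" by (simp add: nn_integral_cmult W_def)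
      also have "(\<integral>\<^sup>+n. (\<integral>\<^sup>+k. ennreal (cenv L (n - k)) * f k \<partial>count_space UNIV) * indicator (near L m) n \<partial>count_space UNIV)
         = (\<integral>\<^sup>+n. \<integral>\<^sup>+e. ennreal (cenv L e) * (f (n - e) * indicator (near L m) n) \<partial>count_space UNIV \<partial>count_space UNIV)"
        by (simp add: nn_integral_convolution_reflect[of "\<lambda>k. ennreal (cenv L k)"] nn_integral_multc[symmetric] mult.assoc)
      also have "\<dots> = (\<integral>\<^sup>+e. ennreal (cenv L e) * (\<integral>\<^sup>+n. f (n - e) * indicator (near L m) n \<partial>count_space UNIV) \<partial>count_space UNIV)"
        by (subst nn_integral_count_space_swap) (simp add: nn_integral_cmult)
      also have "\<dots> = (\<integral>\<^sup>+e. ennreal (cenv L e) * W (m - e) \<partial>count_space UNIV)"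
      proof (rule nn_integral_cong)
        fix e
        have "(\<integral>\<^sup>+n. f (n - e) * indicator (near L m) n \<partial>count_space UNIV)
            = (\<integral>\<^sup>+n. f (n + e - e) * indicator (near L m) (n + e) \<partial>count_space UNIV)"
          by (rule nn_integral_count_space_shift[symmetric])
        also have "\<dots> = W (m - e)"
          unfolding W_def by (rule nn_integral_cong) (auto simp: indicator_def)
        finally show "ennreal (cenv L e) * (\<integral>\<^sup>+n. f (n - e) * indicator (near L m) n \<partial>count_space UNIV) = ennreal (cenv L e) * W (m - e)"
          by simp
      qed
      also have "\<dots> \<le> (\<integral>\<^sup>+e. ennreal (cenv L e) * M \<partial>count_space UNIV)"
        by (intro nn_integral_mono mult_left_mono WM) auto
      also have "\<dots> = ennreal \<eta> * M"
        by (simp add: nn_integral_multc nn_integral_cenv[OF L(1)] \<eta>_def)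
      also have "ennreal \<eta> * W m \<le> ennreal \<eta> * M" by (intro mult_left_mono WM) auto
      finally show ?thesis by (simp add: mult_2 add_mono)
    qed
    have V: "V m \<le> ennreal (P * \<nu> * (4 * real_of_int L + 1) * D powr p) + ennreal (2 * P * \<nu> * \<eta> powr p) * M" for m
    proof -
      let ?c = "\<lambda>k. of_real (window L m k) * c k"
      have "{k. ?c k \<noteq> 0} \<subseteq> near L m"
      proof
        fix k assume "k \<in> {k. ?c k \<noteq> 0}"
        then have "window L m k \<noteq> 0" by auto
        then show "k \<in> near L m" using window_eq_0[OF L(1), of k m] by force
      qed
      then have fin: "finite {k. ?c k \<noteq> 0}" by (rule finite_subset) simp
      have "V m \<le> (\<integral>\<^sup>+k. ennreal (norm (?c k) powr p) \<partial>count_space UNIV)"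
        unfolding V_def f_def
      proof (rule nn_integral_mono)
        fix k
        show "ennreal (norm (c k) powr p) * indicator {m - L..m + L} k \<le> ennreal (norm (?c k) powr p)"
          using window_eq_1[OF L(1), of k m] by (cases "k \<in> {m - L..m + L}") (auto simp: indicator_def)
      qed
      also have "\<dots> \<le> ennreal C * (\<integral>\<^sup>+r. ennreal (norm (app ?c r) powr p) \<partial>count_space S)"
        by (rule H[OF fin])
      also have "\<dots> \<le> ennreal C * (\<integral>\<^sup>+r. ennreal (2 powr p) * (ennreal (D powr p) * indicator (near L m) (pos r)
            + ennreal (\<eta> powr (p - 1)) * Z m (pos r)) \<partial>count_space S)"
      proof (intro mult_left_mono nn_integral_mono)
        fix r assume "r \<in> space (count_space S)"
        then have r: "r \<in> S" "r \<in> R" using S by auto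
        define y where "y = window L m (pos r) * norm (app c r)"
        define z where "z = (\<Sum>\<^sub>\<infinity>k. cker L m (pos r) k * norm (c k))"
        have y0: "0 \<le> y" unfolding y_def using window_nonneg by (intro mult_nonneg_nonneg) auto
        have z0: "0 \<le> z" unfolding z_def by (intro infsum_nonneg mult_nonneg_nonneg cker_nonneg) auto
        have "norm (app ?c r) \<le> y + z"
          unfolding y_def z_def by (rule commutator_le[OF L(1) K r(2)])
        then have "norm (app ?c r) powr p \<le> (y + z) powr p" using p by (intro powr_mono2) auto
        also have "\<dots> \<le> 2 powr p * (y powr p + z powr p)" using y0 z0 p by (intro add_powr_le) auto
        finally have "ennreal (norm (app ?c r) powr p) \<le> ennreal (2 powr p * (y powr p + z powr p))"
          by (rule ennreal_leI)
        also have "\<dots> = ennreal (2 powr p) * (ennreal (y powr p) + ennreal (z powr p))"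
          by (simp add: ennreal_mult)
        also have "\<dots> \<le> ennreal (2 powr p) * (ennreal (D powr p) * indicator (near L m) (pos r)
            + ennreal (\<eta> powr (p - 1)) * Z m (pos r))"
        proof (intro mult_left_mono add_mono)
          show "ennreal (y powr p) \<le> ennreal (D powr p) * indicator (near L m) (pos r)"
          proof (cases "pos r \<in> near L m")
            case True
            have "y \<le> 1 * norm (app c r)" unfolding y_def by (intro mult_right_mono window_le_1) auto
            also have "\<dots> \<le> D" using cD[OF r(1)] by simp
            finally show ?thesis using True y0 p by (simp add: ennreal_leI powr_mono2)
          next
            case False
            then have "window L m (pos r) = 0" by (intro window_eq_0 L(1)) auto
            then show ?thesis using p by (simp add: y_def)
          qed
          show "ennreal (z powr p) \<le> ennreal (\<eta> powr (p - 1)) * Z m (pos r)"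
            unfolding z_def Z_def
            by (rule infsum_weighted_powr_le[where K = K])
              (use cker_summable cker_nonneg cker_sum_le L K p in \<open>auto simp: \<eta>_def\<close>)
        qed auto
        finally show "ennreal (norm (app ?c r) powr p) \<le> \<dots>" .
      qed auto
      also have "\<dots> = ennreal P * (\<integral>\<^sup>+r. ennreal (D powr p) * indicator (near L m) (pos r)
            + ennreal (\<eta> powr (p - 1)) * Z m (pos r) \<partial>count_space S)"
        using C by (simp add: nn_integral_cmult P_def ennreal_mult mult.assoc)
      also have "\<dots> \<le> ennreal P * (of_nat \<nu> * (\<integral>\<^sup>+n. ennreal (D powr p) * indicator (near L m) n
            + ennreal (\<eta> powr (p - 1)) * Z m n \<partial>count_space UNIV))"
        by (intro mult_left_mono nn_integral_count_space_fiber_le[where f = "\<lambda>n. ennreal (D powr p) * indicator (near L m) n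
            + ennreal (\<eta> powr (p - 1)) * Z m n"] fib) auto
      also have "(\<integral>\<^sup>+n. ennreal (D powr p) * indicator (near L m) n
            + ennreal (\<eta> powr (p - 1)) * Z m n \<partial>count_space UNIV)
          = ennreal (4 * real_of_int L + 1) * ennreal (D powr p) + ennreal (\<eta> powr (p - 1)) * (\<integral>\<^sup>+n. Z m n \<partial>count_space UNIV)"
        by (simp add: nn_integral_add nn_integral_cmult nn_integral_near_const[OF L(1)])
      also have "ennreal P * (of_nat \<nu> * (ennreal (4 * real_of_int L + 1) * ennreal (D powr p) + ennreal (\<eta> powr (p - 1)) * (\<integral>\<^sup>+n. Z m n \<partial>count_space UNIV)))
        \<le> ennreal P * (of_nat \<nu> * (ennreal (4 * real_of_int L + 1) * ennreal (D powr p) + ennreal (\<eta> powr (p - 1)) * (2 * (ennreal \<eta> * M))))"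
        by (intro mult_left_mono add_left_mono Z) auto
      also have "\<dots> = ennreal (P * \<nu> * (4 * real_of_int L + 1) * D powr p) + ennreal (2 * P * \<nu> * \<eta> powr p) * M"
      proof -
        have "\<eta> powr p = \<eta> powr (p - 1) * \<eta>"
          using \<eta> p by (cases "\<eta> = 0") (auto simp: powr_mult_base mult.commute)
        then have 1: "ennreal (2 * P * \<nu> * \<eta> powr p) = 2 * ennreal P * of_nat \<nu> * (ennreal (\<eta> powr (p - 1)) * ennreal \<eta>)"
          using P \<eta> by (simp add: ennreal_mult ennreal_of_nat_eq_real_of_nat)
        have 2: "ennreal (P * \<nu> * (4 * real_of_int L + 1) * D powr p) = ennreal P * of_nat \<nu> * ennreal (4 * real_of_int L + 1) * ennreal (D powr p)"
          using P L(1) by (simp add: ennreal_mult ennreal_of_nat_eq_real_of_nat)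
        show ?thesis unfolding 1 2 by (simp only: distrib_left mult_ac)
      qed
      finally show ?thesis .
    qed
    \<comment> \<open>The interval of radius \<open>2 * L\<close> is covered by two plateaus of
      radius \<open>L\<close>.\<close>
    have WV: "W m \<le> V (m - L) + V (m + L)" for m
    proof -
      have "W m \<le> (\<integral>\<^sup>+k. f k * indicator {m - L - L..m - L + L} k + f k * indicator {m + L - L..m + L + L} k \<partial>count_space UNIV)"
        unfolding W_def by (intro nn_integral_mono) (auto simp: indicator_def)
      also have "\<dots> = V (m - L) + V (m + L)" unfolding V_def by (simp add: nn_integral_add)
      finally show ?thesis .
    qed
    define e0 where "e0 = ennreal (2 * P * \<nu> * (4 * real_of_int L + 1) * D powr p)"
    have "W m \<le> e0 + ennreal (1/2) * M" for m
    proof -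
      let ?x = "ennreal (P * \<nu> * (4 * real_of_int L + 1) * D powr p)" and ?y = "ennreal (2 * P * \<nu> * \<eta> powr p)"
      have "W m \<le> (?x + ?y * M) + (?x + ?y * M)" by (rule order_trans[OF WV add_mono[OF V V]])
      also have "\<dots> = 2 * ?x + (2 * ?y) * M"
      proof -
        have "(x + y * z) + (x + y * z) = 2 * x + (2 * y) * z" for x y z :: ennreal
          by (simp only: mult_2 distrib_right add_ac)
        then show ?thesis .
      qed
      also have "2 * ?y = ennreal (4 * P * \<nu> * \<eta> powr p)"
        using P by (simp add: ennreal_mult mult.assoc[symmetric])
      also have "2 * ?x = e0" unfolding e0_def using P L(1) by (simp add: ennreal_mult mult.assoc)
      also have "e0 + ennreal (4 * P * \<nu> * \<eta> powr p) * M \<le> e0 + ennreal (1/2) * M"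
        using small by (intro add_left_mono mult_right_mono ennreal_leI) auto
      finally show ?thesis .
    qed
    then have "M \<le> e0 + ennreal (1/2) * M" unfolding M_def by (intro SUP_least)
    then have M: "M \<le> 2 * e0" using Mfin by (rule ennreal_absorb_half)
    have "f k0 * indicator (near L k0) k0 \<le> W k0" unfolding W_def by (rule nn_integral_ge_point) simp
    then have "f k0 \<le> M" using L(1) WM[of k0] by simp
    then have "ennreal (norm (c k0) powr p) \<le> 2 * e0" using M by (simp add: f_def)
    also have "\<dots> = ennreal (4 * P * \<nu> * (4 * real_of_int L + 1) * D powr p)"
      unfolding e0_def using P L(1) by (simp add: ennreal_mult mult.assoc[symmetric])
    also have "\<dots> \<le> ennreal (E * D powr p)"
      unfolding E_def using P L(1) by (intro ennreal_leI mult_right_mono mult_left_mono) auto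
    finally have "norm (c k0) powr p \<le> E * D powr p" using E by (subst (asm) ennreal_le_iff) auto
    then have "(norm (c k0) powr p) powr (1/p) \<le> (E * D powr p) powr (1/p)"
      using p by (intro powr_mono2) auto
    then show ?thesis using p D E by (simp add: powr_powr powr_mult C'_def)
  qed
  then show ?thesis using C' by blast
qed

end

section \<open>Weak limits of sets\<close>

text \<open>Cantor's diagonal argument, with Bolzano-Weierstrass at each index.\<close>

lemma countable_pointwise_convergent_subsequence:
  fixes f :: "nat \<Rightarrow> 'i::countable \<Rightarrow> 'a::heine_borel"
  assumes "\<And>i. bounded (range (\<lambda>n. f n i))"
  obtains r where "strict_mono r" "\<And>i. convergent (\<lambda>n. f (r n) i)"
proof -
  define P where "P m s \<longleftrightarrow> (\<forall>i. to_nat i = m \<longrightarrow> convergent (\<lambda>n. f (s n) i))" for m and s :: "nat \<Rightarrow> nat"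
  interpret subseqs P
  proof
    fix m and s :: "nat \<Rightarrow> nat" assume s: "strict_mono s"
    show "\<exists>r'. strict_mono r' \<and> P m (s \<circ> r')"
    proof (cases "\<exists>i::'i. to_nat i = m")
      case True
      then obtain i :: 'i where i: "to_nat i = m" by blast
      have "bounded (range (\<lambda>n. f (s n) i))"
        by (rule bounded_subset[OF assms[of i]]) auto
      then obtain l r where "strict_mono r" "((\<lambda>n. f (s n) i) \<circ> r) \<longlonglongrightarrow> l"
        using bounded_imp_convergent_subsequence by blast
      moreover have "i' = i" if "to_nat i' = m" for i' using that i by (metis from_nat_to_nat)
      ultimately have "P m (s \<circ> r)" unfolding P_def convergent_def o_def by metis
      then show ?thesis using \<open>strict_mono r\<close> by blast
    next
      case False
      then show ?thesis unfolding P_def using strict_mono_id by blast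
    qed
  qed
  \<comment> \<open>From index \<open>Suc m\<close> on, the diagonal sequence is a subsequence of
    the one extracted for index \<open>m\<close>; dropping finitely many terms does not affect
    convergence.\<close>
  have P: "P m (diagseq \<circ> (+) (Suc m))" for m
  proof -
    have "P m (diagseq \<circ> (+) (Suc m))"
    proof (rule diagseq_holds)
      fix r s :: "nat \<Rightarrow> nat" and n assume rs: "strict_mono r" "P n s"
      then show "P n (s \<circ> r)"
        using convergent_subseq_convergent[of "\<lambda>k. f (s k) _", OF _ rs(1)] unfolding P_def o_def by blast
    qed
    then show ?thesis by blast
  qed
  have "convergent (\<lambda>n. f (diagseq n) i)" for i
  proof -
    have "convergent (\<lambda>n. f ((diagseq \<circ> (+) (Suc (to_nat i))) n) i)"
      using P[of "to_nat i"] by (subst (asm) P_def) blast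
    then have "convergent (\<lambda>n. f (diagseq (n + Suc (to_nat i))) i)" by (simp add: o_def add.commute)
    then show ?thesis using convergent_ignore_initial_segment[of "\<lambda>n. f (diagseq n) i"] by blast
  qed
  then show ?thesis using that subseq_diagseq by blast
qed

lemma convergent_of_bool_imp_eventually_const:
  assumes "convergent (\<lambda>n. of_bool (P n) :: real)"
  shows "(\<forall>\<^sub>F n in sequentially. P n) \<or> (\<forall>\<^sub>F n in sequentially. \<not> P n)"
proof -
  obtain l where l: "(\<lambda>n. of_bool (P n) :: real) \<longlonglongrightarrow> l" using assms by (auto simp: convergent_def)
  show ?thesis
  proof (cases "l > 0")
    case True
    then have "\<forall>\<^sub>F n in sequentially. of_bool (P n) > (0::real)" using l order_tendstoD(1) by blast
    then show ?thesis by simp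
  next
    case False
    then have "\<forall>\<^sub>F n in sequentially. of_bool (P n) < (1::real)" using l by (intro order_tendstoD(2)[OF l]) auto
    then show ?thesis by simp
  qed
qed

text \<open>The limit consists of the points all of whose rational neighbourhoods are eventually hit; for the
  extracted subsequence each rational interval is either eventually hit or eventually missed.\<close>

lemma weak_conv_subsequence:
  fixes Ls :: "nat \<Rightarrow> nat \<Rightarrow> real set"
  obtains r \<Gamma> where "strict_mono r" "\<And>j. weak_conv (\<lambda>n. Ls (r n) j) (\<Gamma> j)"
proof -
  define hit where "hit n j a b \<longleftrightarrow> Ls n j \<inter> {real_of_rat a<..<real_of_rat b} \<noteq> {}" for n j a b
  \<comment> \<open>The indicators of hitting are bounded sequences indexed by a component and two
    rationals. One extraction treats all components, as \<open>WZ\<close> asks for a common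
    sequence, and a convergent sequence of zeros and ones is eventually constant.\<close>
  obtain r where r: "strict_mono r"
    and conv: "\<And>i. convergent (\<lambda>n. (case i of (j, a, b) \<Rightarrow> of_bool (hit (r n) j a b)) :: real)"
  proof (rule countable_pointwise_convergent_subsequence[of "\<lambda>n (j, a, b). of_bool (hit n j a b) :: real"])
    fix i :: "nat \<times> rat \<times> rat"
    show "bounded (range (\<lambda>n. (case i of (j, a, b) \<Rightarrow> of_bool (hit n j a b)) :: real))"
      by (rule boundedI[of _ 1]) (auto split: prod.splits)
  qed (use that in blast)
  define ev where "ev j a b \<longleftrightarrow> (\<forall>\<^sub>F n in sequentially. hit (r n) j a b)" for j a b
  have nev: "\<forall>\<^sub>F n in sequentially. \<not> hit (r n) j a b" if "\<not> ev j a b" for j a b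
    using convergent_of_bool_imp_eventually_const[of "\<lambda>n. hit (r n) j a b"] conv[of "(j, a, b)"] that
    by (auto simp: ev_def)
  define \<Gamma> where "\<Gamma> j = {x. \<forall>a b. real_of_rat a < x \<and> x < real_of_rat b \<longrightarrow> ev j a b}" for j
  \<comment> \<open>Points hitting the interval accumulate at some \<open>l\<close>. A rational
    neighbourhood of \<open>l\<close> is hit infinitely often, hence not eventually missed, hence
    eventually hit. The accumulation point may be an endpoint, so only the closed interval is
    obtained.\<close>
  have closed_hit: "\<exists>y\<in>\<Gamma> j. real_of_rat a \<le> y \<and> y \<le> real_of_rat b" if "ev j a b" for j a b
  proof -
    from that obtain n0 where n0: "\<And>n. n \<ge> n0 \<Longrightarrow> hit (r n) j a b"
      unfolding ev_def eventually_sequentially by blast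
    then have "\<forall>n. \<exists>y. y \<in> Ls (r (n + n0)) j \<inter> {real_of_rat a<..<real_of_rat b}"
      unfolding hit_def by (metis all_not_in_conv le_add2)
    then obtain y where y: "\<And>n. y n \<in> Ls (r (n + n0)) j \<inter> {real_of_rat a<..<real_of_rat b}" by metis
    have "\<forall>n. y n \<in> {real_of_rat a..real_of_rat b}"
    proof
      fix n show "y n \<in> {real_of_rat a..real_of_rat b}" using y[of n] by auto
    qed
    then obtain l s where l: "l \<in> {real_of_rat a..real_of_rat b}" "strict_mono s" "(y \<circ> s) \<longlonglongrightarrow> l"
      using compact_Icc[of "real_of_rat a" "real_of_rat b"] unfolding compact_def by metis
    have "ev j a' b'" if ab: "real_of_rat a' < l" "l < real_of_rat b'" for a' b'
    proof (rule ccontr)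
      assume "\<not> ev j a' b'"
      then obtain n1 where n1: "\<And>n. n \<ge> n1 \<Longrightarrow> \<not> hit (r n) j a' b'"
        using nev unfolding eventually_sequentially by blast
      have "\<forall>\<^sub>F n in sequentially. y (s n) \<in> {real_of_rat a'<..<real_of_rat b'}"
        using l(3) ab by (intro topological_tendstoD) (auto simp: o_def)
      then obtain n2 where n2: "\<And>n. n \<ge> n2 \<Longrightarrow> y (s n) \<in> {real_of_rat a'<..<real_of_rat b'}"
        unfolding eventually_sequentially by blast
      define n where "n = max n1 n2"
      have "hit (r (s n + n0)) j a' b'" using n2[of n] y[of "s n"] unfolding hit_def n_def by auto
      moreover have "n1 \<le> s n + n0" using seq_suble[OF l(2), of n] by (simp add: n_def)
      ultimately show False using n1 by blast
    qed
    then have "l \<in> \<Gamma> j" by (simp add: \<Gamma>_def)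
    then show ?thesis using l(1) by auto
  qed
  have "weak_conv (\<lambda>n. Ls (r n) j) (\<Gamma> j)" for j
    unfolding weak_conv_def
  proof (intro allI impI)
    fix a b e :: real assume e: "e > 0"
    \<comment> \<open>Finitely many rational intervals shorter than \<open>e\<close> cover
      \<open>{a..b}\<close>; a single \<open>n0\<close> then decides all of them, and two points of
      one such interval are closer than \<open>e\<close>.\<close>
    define I where "I = {(x, y) | x y :: rat. real_of_rat y - real_of_rat x < e}"
    have "{a..b} \<subseteq> \<Union>((\<lambda>(x, y). {real_of_rat x<..<real_of_rat y}) ` I)"
    proof
      fix x :: real assume "x \<in> {a..b}"
      obtain q1 where q1: "x - e / 2 < real_of_rat q1" "real_of_rat q1 < x"
        using of_rat_dense[of "x - e/2" x] e by auto
      obtain q2 where q2: "x < real_of_rat q2" "real_of_rat q2 < x + e / 2"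
        using of_rat_dense[of x "x + e/2"] e by auto
      have "(q1, q2) \<in> I" using q1 q2 by (auto simp: I_def)
      then show "x \<in> \<Union>((\<lambda>(x, y). {real_of_rat x<..<real_of_rat y}) ` I)" using q1 q2 by force
    qed
    then obtain I' where I': "I' \<subseteq> I" "finite I'" "{a..b} \<subseteq> \<Union>((\<lambda>(x, y). {real_of_rat x<..<real_of_rat y}) ` I')"
      using compactE_image[of "{a..b}" I "\<lambda>(x, y). {real_of_rat x<..<real_of_rat y}"] compact_Icc
      by (auto simp: case_prod_unfold)
    have "\<forall>\<^sub>F n in sequentially. \<forall>(x, y)\<in>I'. hit (r n) j x y \<longleftrightarrow> ev j x y"
    proof (intro eventually_ball_finite I'(2) ballI)
      fix xy assume "xy \<in> I'"
      obtain x y where xy: "xy = (x, y)" by (cases xy)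
      show "\<forall>\<^sub>F n in sequentially. case xy of (x, y) \<Rightarrow> hit (r n) j x y \<longleftrightarrow> ev j x y"
      proof (cases "ev j x y")
        case True
        then show ?thesis using xy by (simp add: ev_def)
      next
        case False
        then show ?thesis using xy nev[OF False] by simp
      qed
    qed
    then obtain n0 where n0: "\<And>n x y. n \<ge> n0 \<Longrightarrow> (x, y) \<in> I' \<Longrightarrow> hit (r n) j x y \<longleftrightarrow> ev j x y"
      unfolding eventually_sequentially by fast
    show "\<exists>n0. \<forall>n\<ge>n0. Ls (r n) j \<inter> {a<..<b} \<subseteq> eps_nbhd (\<Gamma> j) e \<and> \<Gamma> j \<inter> {a<..<b} \<subseteq> eps_nbhd (Ls (r n) j) e"
    proof (intro exI[of _ n0] allI impI conjI subsetI)
      fix n z assume n: "n \<ge> n0" and z: "z \<in> Ls (r n) j \<inter> {a<..<b}"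
      have "z \<in> {a..b}" using z by auto
      then obtain x y where xy: "(x, y) \<in> I'" "real_of_rat x < z" "z < real_of_rat y" using I'(3) by auto
      then have "hit (r n) j x y" using z unfolding hit_def by auto
      then have "ev j x y" using n0[OF n xy(1)] by blast
      then obtain w where w: "w \<in> \<Gamma> j" "real_of_rat x \<le> w" "w \<le> real_of_rat y" using closed_hit by blast
      have "real_of_rat y - real_of_rat x < e" using xy(1) I'(1) by (auto simp: I_def)
      then have "\<bar>z - w\<bar> < e" using w xy by linarith
      then show "z \<in> eps_nbhd (\<Gamma> j) e" using w(1) by (auto simp: eps_nbhd_def)
    next
      fix n z assume n: "n \<ge> n0" and z: "z \<in> \<Gamma> j \<inter> {a<..<b}"
      have "z \<in> {a..b}" using z by auto
      then obtain x y where xy: "(x, y) \<in> I'" "real_of_rat x < z" "z < real_of_rat y" using I'(3) by auto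
      then have "ev j x y" using z by (auto simp: \<Gamma>_def)
      then have "hit (r n) j x y" using n0[OF n xy(1)] by blast
      then obtain w where w: "w \<in> Ls (r n) j" "real_of_rat x < w" "w < real_of_rat y" unfolding hit_def by auto
      have "real_of_rat y - real_of_rat x < e" using xy(1) I'(1) by (auto simp: I_def)
      then have "\<bar>z - w\<bar> < e" using w xy by linarith
      then show "z \<in> eps_nbhd (Ls (r n) j) e" using w(1) by (auto simp: eps_nbhd_def)
    qed
  qed
  then show ?thesis using that r by blast
qed

lemma weak_conv_approx:
  assumes "weak_conv Ls L" "x \<in> L"
  obtains y where "\<forall>\<^sub>F n in sequentially. y n \<in> Ls n" "y \<longlonglongrightarrow> x"
proof -
  have near: "\<forall>\<^sub>F n in sequentially. \<exists>y\<in>Ls n. \<bar>x - y\<bar> < e" if "e > 0" for e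
  proof -
    obtain n0 where n0: "\<And>n. n \<ge> n0 \<Longrightarrow> L \<inter> {x - 1<..<x + 1} \<subseteq> eps_nbhd (Ls n) e"
      using assms(1) \<open>e > 0\<close> unfolding weak_conv_def by metis
    show ?thesis unfolding eventually_sequentially
    proof (intro exI[of _ n0] allI impI)
      fix n assume "n \<ge> n0"
      then have "x \<in> eps_nbhd (Ls n) e" using n0[of n] assms(2) by auto
      then show "\<exists>y\<in>Ls n. \<bar>x - y\<bar> < e" by (auto simp: eps_nbhd_def)
    qed
  qed
  \<comment> \<open>A nearest point need not exist, so the choice has slack
    \<open>inverse (real (Suc n))\<close>. It does not depend on an accuracy, so one sequence
    converges for every \<open>e\<close>.\<close>
  define y where "y n = (SOME y. y \<in> Ls n \<and> dist x y < infdist x (Ls n) + inverse (real (Suc n)))" for n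
  have y: "y n \<in> Ls n \<and> dist x (y n) < infdist x (Ls n) + inverse (real (Suc n))" if ne: "Ls n \<noteq> {}" for n
  proof -
    have "(INF a\<in>Ls n. dist x a) < infdist x (Ls n) + inverse (real (Suc n))"
      using ne by (simp add: infdist_notempty)
    then have "\<exists>y. y \<in> Ls n \<and> dist x y < infdist x (Ls n) + inverse (real (Suc n))"
      using ne by (subst (asm) cINF_less_iff) (auto intro!: bdd_belowI[of _ 0])
    then show ?thesis unfolding y_def by (rule someI_ex)
  qed
  have ev: "\<forall>\<^sub>F n in sequentially. Ls n \<noteq> {}" using near[of 1] by (auto elim!: eventually_mono)
  show ?thesis
  proof (rule that)
    show "\<forall>\<^sub>F n in sequentially. y n \<in> Ls n" using ev y by (auto elim!: eventually_mono)
    show "y \<longlonglongrightarrow> x"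
    proof (rule tendstoI)
      fix e :: real assume e: "e > 0"
      have "\<forall>\<^sub>F n in sequentially. inverse (real (Suc n)) < e / 2"
        using LIMSEQ_inverse_real_of_nat e by (intro order_tendstoD(2)) auto
      moreover have "\<forall>\<^sub>F n in sequentially. \<exists>y\<in>Ls n. \<bar>x - y\<bar> < e / 2" using near[of "e/2"] e by simp
      ultimately show "\<forall>\<^sub>F n in sequentially. dist (y n) x < e"
      proof eventually_elim
        case (elim n)
        then obtain z where z: "z \<in> Ls n" "\<bar>x - z\<bar> < e / 2" by blast
        have "infdist x (Ls n) \<le> dist x z" by (rule infdist_le[OF z(1)])
        moreover have "dist x (y n) < infdist x (Ls n) + inverse (real (Suc n))" using y[of n] z(1) by blast
        ultimately show ?case using z(2) elim(1) by (simp only: dist_commute[of "y n"]) (simp only: dist_real_def)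
      qed
    qed
  qed
qed

text \<open>Pigeonhole: after cutting a unit interval into cells of length \<delta>, different
  points of the set fall into different cells.\<close>

lemma separated_fiber_card:
  assumes "separated S"
  obtains \<nu> where "\<And>n::int. finite {x \<in> S. \<lfloor>x\<rfloor> = n}" "\<And>n. card {x \<in> S. \<lfloor>x\<rfloor> = n} \<le> \<nu>"
proof -
  obtain \<delta> where \<delta>: "\<delta> > 0" "\<And>x y. x \<in> S \<Longrightarrow> y \<in> S \<Longrightarrow> x \<noteq> y \<Longrightarrow> \<delta> \<le> \<bar>x - y\<bar>"
    using assms unfolding separated_def by blast
  have *: "inj_on (\<lambda>x. \<lfloor>(x - real_of_int n) / \<delta>\<rfloor>) {x \<in> S. \<lfloor>x\<rfloor> = n}"
       "(\<lambda>x. \<lfloor>(x - real_of_int n) / \<delta>\<rfloor>) ` {x \<in> S. \<lfloor>x\<rfloor> = n} \<subseteq> {0..\<lfloor>1 / \<delta>\<rfloor>}" for n :: int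
  proof -
    show "inj_on (\<lambda>x. \<lfloor>(x - real_of_int n) / \<delta>\<rfloor>) {x \<in> S. \<lfloor>x\<rfloor> = n}"
    proof (rule inj_onI)
      fix x y :: real
      assume xy: "x \<in> {x \<in> S. \<lfloor>x\<rfloor> = n}" "y \<in> {x \<in> S. \<lfloor>x\<rfloor> = n}"
        and eq: "\<lfloor>(x - real_of_int n) / \<delta>\<rfloor> = \<lfloor>(y - real_of_int n) / \<delta>\<rfloor>"
      have "\<bar>(x - real_of_int n) / \<delta> - (y - real_of_int n) / \<delta>\<bar> < 1" using eq by linarith
      then have "\<bar>x - y\<bar> / \<delta> < 1" using \<delta>(1) by (simp add: diff_divide_distrib[symmetric])
      then have "\<bar>x - y\<bar> < \<delta>" using \<delta>(1) by simp
      then show "x = y" using \<delta>(2)[of x y] xy by auto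
    qed
    show "(\<lambda>x. \<lfloor>(x - real_of_int n) / \<delta>\<rfloor>) ` {x \<in> S. \<lfloor>x\<rfloor> = n} \<subseteq> {0..\<lfloor>1 / \<delta>\<rfloor>}"
    proof
      fix z assume "z \<in> (\<lambda>x. \<lfloor>(x - real_of_int n) / \<delta>\<rfloor>) ` {x \<in> S. \<lfloor>x\<rfloor> = n}"
      then obtain x where x: "\<lfloor>x\<rfloor> = n" "z = \<lfloor>(x - real_of_int n) / \<delta>\<rfloor>" by auto
      have "0 \<le> x - n" "x - n \<le> 1" using x(1) by linarith+
      then show "z \<in> {0..\<lfloor>1 / \<delta>\<rfloor>}" using x(2) \<delta>(1) by (auto intro!: floor_mono divide_right_mono)
    qed
  qed
  show ?thesis
  proof (rule that)
    show "finite {x \<in> S. \<lfloor>x\<rfloor> = n}" for n using *[of n] by (rule inj_on_finite) simp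
    show "card {x \<in> S. \<lfloor>x\<rfloor> = n} \<le> card {0..\<lfloor>1 / \<delta>\<rfloor>}" for n using *[of n] by (rule card_inj_on_le) simp
  qed
qed

section \<open>Shift-invariant spaces\<close>

text \<open>Makes dominated convergence available for synthesis sums.\<close>

lemma infsum_eq_integral_count_space:
  fixes f :: "'a \<Rightarrow> complex"
  assumes "(\<lambda>x. norm (f x)) summable_on A"
  shows "infsum f A = (\<integral>x. f x \<partial>count_space A)"
proof -
  have *: "Infinite_Set_Sum.abs_summable_on f A" using assms abs_summable_equivalent by blast
  show ?thesis using infsetsum_infsum[OF *] by (simp add: infsetsum_def)
qed

lemma summable_on_sum_finite:
  fixes f :: "'i \<Rightarrow> 'a \<Rightarrow> real"
  assumes "finite I" "\<And>i. i \<in> I \<Longrightarrow> f i summable_on A"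
  shows "(\<lambda>x. \<Sum>i\<in>I. f i x) summable_on A"
  using assms by (induction I rule: finite_induct) (auto intro!: summable_on_add)

locale generators =
  fixes N :: nat and G :: "nat \<Rightarrow> real \<Rightarrow> complex"
  assumes W0: "j < N \<Longrightarrow> W0 (G j)"
begin

text \<open>The local maxima from the definition of W_0, added over the components: one envelope for
  all \<open>G j\<close>, whose total mass is the sum of the W_0 norms.\<close>

definition env :: "int \<Rightarrow> real" where
  "env n = (\<Sum>j<N. Sup ((\<lambda>x. norm (G j x)) ` {real_of_int n..real_of_int n + 1}))"

lemma continuous_G: "j < N \<Longrightarrow> continuous_on A (G j)"
  using W0 unfolding W0_def by (meson continuous_on_subset subset_UNIV)

lemma norm_G_le_Sup:
  assumes "j < N" "y \<in> {real_of_int n..real_of_int n + 1}"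
  shows "norm (G j y) \<le> Sup ((\<lambda>x. norm (G j x)) ` {real_of_int n..real_of_int n + 1})"
proof (rule cSup_upper)
  have "compact ((\<lambda>x. norm (G j x)) ` {real_of_int n..real_of_int n + 1})"
    by (intro compact_continuous_image continuous_on_norm continuous_G assms compact_Icc)
  then show "bdd_above ((\<lambda>x. norm (G j x)) ` {real_of_int n..real_of_int n + 1})"
    by (intro bounded_imp_bdd_above compact_imp_bounded)
qed (use assms in auto)

lemma Sup_G_nonneg: "j < N \<Longrightarrow> 0 \<le> Sup ((\<lambda>x. norm (G j x)) ` {real_of_int n..real_of_int n + 1})"
  using norm_G_le_Sup[of j "real_of_int n" n] by (smt (verit) atLeastAtMost_iff norm_ge_zero)

lemma norm_G_le_env:
  assumes "j < N"
  shows "norm (G j (x - real_of_int k)) \<le> env (\<lfloor>x\<rfloor> - k)"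
proof -
  have "x - real_of_int k \<in> {real_of_int (\<lfloor>x\<rfloor> - k)..real_of_int (\<lfloor>x\<rfloor> - k) + 1}"
    by (simp add: algebra_simps) linarith
  then have "norm (G j (x - real_of_int k))
      \<le> Sup ((\<lambda>x. norm (G j x)) ` {real_of_int (\<lfloor>x\<rfloor> - k)..real_of_int (\<lfloor>x\<rfloor> - k) + 1})"
    by (rule norm_G_le_Sup[OF assms])
  also have "\<dots> \<le> env (\<lfloor>x\<rfloor> - k)"
    unfolding env_def by (rule member_le_sum) (use assms in \<open>auto intro!: Sup_G_nonneg simp del: of_int_diff\<close>)
  finally show ?thesis .
qed

text \<open>Every real point in every component is a row. A tuple of sampling sets only selects
  rows, so the same matrix serves \<Lambda> and all its weak limits.\<close>

sublocale dominated_matrix "{..<N} \<times> UNIV" "\<lambda>(j, x). \<lfloor>x\<rfloor>" "\<lambda>(j, x) k. G j (x - real_of_int k)" env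
proof
  show "norm ((case r of (j, x) \<Rightarrow> \<lambda>k. G j (x - real_of_int k)) k) \<le> env ((case r of (j, x) \<Rightarrow> \<lfloor>x\<rfloor>) - k)"
    if "r \<in> {..<N} \<times> UNIV" for r k
    using that norm_G_le_env by auto
  show "0 \<le> env n" for n unfolding env_def using Sup_G_nonneg by (intro sum_nonneg) auto
  show "env summable_on UNIV"
    unfolding env_def using W0 by (intro summable_on_sum_finite) (auto simp: W0_def)
qed

lemma app_eq_synth: "app c (j, x) = synth G c j x"
  by (simp add: app_def synth_def)

lemma synth_abs_summable:
  assumes "\<And>k. norm (c k) \<le> K" "j < N"
  shows "(\<lambda>k. norm (c k * G j (x - real_of_int k))) summable_on UNIV"
  using app_abs_summable[of c K "(j, x)"] assms by simp

lemma synth_translate: "synth G c j (x + real_of_int n) = synth G (\<lambda>k. c (k + n)) j x"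
proof -
  have b: "bij_betw (\<lambda>k::int. k + n) UNIV UNIV"
    by (auto intro!: bij_betwI[where g = "\<lambda>k. k - n"])
  show ?thesis
    unfolding synth_def
    using infsum_reindex_bij_betw[OF b, of "\<lambda>k. c k * G j (x + real_of_int n - real_of_int k)"] by simp
qed

text \<open>Coefficients converge only index by index and the evaluation points move; dominated
  convergence applies because the envelope supplies a summable bound independent of
  \<open>n\<close>.\<close>

lemma synth_tendsto:
  assumes d: "\<And>n k. norm (d n k) \<le> 1" and lim: "\<And>k. (\<lambda>n. d n k) \<longlonglongrightarrow> d' k"
    and x: "x \<longlonglongrightarrow> y" and j: "j < N"
  shows "(\<lambda>n. synth G (d n) j (x n)) \<longlonglongrightarrow> synth G d' j y"
proof -
  have d': "norm (d' k) \<le> 1" for k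
    using tendsto_norm[OF lim[of k]] d by (intro LIMSEQ_le_const2) auto
  have "\<forall>\<^sub>F n in sequentially. dist (x n) y < 1" using x by (intro tendstoD) auto
  then obtain n0 where n0: "\<And>n. n \<ge> n0 \<Longrightarrow> \<bar>x n - y\<bar> < 1"
    unfolding eventually_sequentially dist_real_def by blast
  \<comment> \<open>Points within distance 1 of \<open>y\<close> have integer part
    \<open>\<lfloor>y\<rfloor> - 1\<close>, \<open>\<lfloor>y\<rfloor>\<close> or
    \<open>\<lfloor>y\<rfloor> + 1\<close>; the sum of the three envelopes dominates all
    cases.\<close>
  define w where "w k = env (\<lfloor>y\<rfloor> - 1 - k) + env (\<lfloor>y\<rfloor> - k) + env (\<lfloor>y\<rfloor> + 1 - k)" for k
  have w_summ: "w summable_on UNIV"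
    unfolding w_def by (intro summable_on_add) (simp_all add: summable_on_reflect env_summable)
  have wi: "integrable (count_space UNIV) w"
  proof -
    have "(\<lambda>k. norm (w k)) summable_on UNIV"
      using w_summ by (rule summable_on_cong[THEN iffD1, rotated]) (simp add: w_def env_nonneg)
    then show ?thesis
      using abs_summable_equivalent[of w UNIV] by (simp add: Infinite_Set_Sum.abs_summable_on_def)
  qed
  have "(\<lambda>n. \<integral>k. d (n + n0) k * G j (x (n + n0) - real_of_int k) \<partial>count_space UNIV)
      \<longlonglongrightarrow> (\<integral>k. d' k * G j (y - real_of_int k) \<partial>count_space UNIV)"
  proof (rule integral_dominated_convergence[OF _ _ wi])
    have "(\<lambda>n. d (n + n0) k * G j (x (n + n0) - real_of_int k)) \<longlonglongrightarrow> d' k * G j (y - real_of_int k)" for k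
    proof (intro tendsto_mult)
      show "(\<lambda>n. d (n + n0) k) \<longlonglongrightarrow> d' k" by (rule LIMSEQ_ignore_initial_segment[OF lim])
      have "isCont (G j) (y - real_of_int k)"
        using continuous_G[OF j, of UNIV] by (simp add: continuous_on_eq_continuous_at)
      moreover have "(\<lambda>n. x (n + n0) - real_of_int k) \<longlonglongrightarrow> y - real_of_int k"
        by (intro tendsto_diff tendsto_const LIMSEQ_ignore_initial_segment x)
      ultimately show "(\<lambda>n. G j (x (n + n0) - real_of_int k)) \<longlonglongrightarrow> G j (y - real_of_int k)"
        by (rule isCont_tendsto_compose)
    qed
    then show "AE k in count_space UNIV. (\<lambda>n. d (n + n0) k * G j (x (n + n0) - real_of_int k)) \<longlonglongrightarrow> d' k * G j (y - real_of_int k)"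
      by simp
    fix n
    have "norm (d (n + n0) k * G j (x (n + n0) - real_of_int k)) \<le> w k" for k
    proof -
      have "norm (d (n + n0) k * G j (x (n + n0) - real_of_int k)) \<le> 1 * env (\<lfloor>x (n + n0)\<rfloor> - k)"
        unfolding norm_mult using d norm_G_le_env[OF j] by (intro mult_mono) auto
      moreover have "\<lfloor>x (n + n0)\<rfloor> = \<lfloor>y\<rfloor> - 1 \<or> \<lfloor>x (n + n0)\<rfloor> = \<lfloor>y\<rfloor> \<or> \<lfloor>x (n + n0)\<rfloor> = \<lfloor>y\<rfloor> + 1"
        using n0[of "n + n0"] by linarith
      ultimately show ?thesis unfolding w_def
        using env_nonneg[of "\<lfloor>y\<rfloor> - 1 - k"] env_nonneg[of "\<lfloor>y\<rfloor> - k"] env_nonneg[of "\<lfloor>y\<rfloor> + 1 - k"] by auto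
    qed
    then show "AE k in count_space UNIV. norm (d (n + n0) k * G j (x (n + n0) - real_of_int k)) \<le> w k" by simp
  qed auto
  then have "(\<lambda>n. synth G (d (n + n0)) j (x (n + n0))) \<longlonglongrightarrow> synth G d' j y"
    unfolding synth_def using infsum_eq_integral_count_space[OF synth_abs_summable[OF d j]]
      infsum_eq_integral_count_space[OF synth_abs_summable[OF d' j]] by simp
  then show ?thesis by (rule LIMSEQ_offset)
qed

lemma G_tendsto_0:
  assumes j: "j < N"
  shows "(G j \<longlongrightarrow> 0) at_infinity"
proof (rule tendstoI)
  fix e :: real assume e: "e > 0"
  obtain F where F: "finite F" "infsum env UNIV - sum env F < e" using env_tail[OF e] by blast
  have small: "env n < e" if "n \<notin> F" for n
  proof -
    have "sum env (insert n F) \<le> infsum env UNIV"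
      using F(1) env_nonneg env_summable by (intro finite_sum_le_infsum) auto
    then show ?thesis using F that by simp
  qed
  obtain Q where Q: "\<And>n. n \<in> F \<Longrightarrow> \<bar>n\<bar> \<le> Q"
    using F(1) by (meson finite_imageI Max_ge image_eqI)
  show "\<forall>\<^sub>F x in at_infinity. dist (G j x) 0 < e"
    unfolding eventually_at_infinity
  proof (intro exI[of _ "real_of_int Q + 2"] allI impI)
    fix x :: real assume x: "real_of_int Q + 2 \<le> norm x"
    have "\<lfloor>x\<rfloor> \<notin> F"
    proof
      assume "\<lfloor>x\<rfloor> \<in> F"
      then have "\<bar>\<lfloor>x\<rfloor>\<bar> \<le> Q" by (rule Q)
      then show False using x by (simp add: abs_le_iff) linarith
    qed
    then show "dist (G j x) 0 < e" using small[of "\<lfloor>x\<rfloor>"] norm_G_le_env[OF j, of x 0] by simp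
  qed
qed

text \<open>The lower bound on l^\<infinity>, written with arbitrary real bounds instead of suprema.
  \<open>K\<close> only expresses boundedness; the constant depends on neither \<open>K\<close> nor
  \<open>D\<close>, so windowing, translating and limits keep it.\<close>

definition sup_stable :: "(nat \<Rightarrow> real set) \<Rightarrow> real \<Rightarrow> bool" where
  "sup_stable \<Lambda> C \<longleftrightarrow> (\<forall>c K D k. (\<forall>k. norm (c k) \<le> K) \<longrightarrow> 0 \<le> D \<longrightarrow>
      (\<forall>r\<in>Sigma {..<N} \<Lambda>. norm (app c r) \<le> D) \<longrightarrow> norm (c k) \<le> C * D)"

lemma sup_stableD:
  assumes "sup_stable \<Lambda> C" "\<And>k. norm (c k) \<le> K" "0 \<le> D"
    "\<And>j x. j < N \<Longrightarrow> x \<in> \<Lambda> j \<Longrightarrow> norm (synth G c j x) \<le> D"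
  shows "norm (c k) \<le> C * D"
proof -
  have "\<forall>r\<in>Sigma {..<N} \<Lambda>. norm (app c r) \<le> D" using assms(4) by (auto simp: app_eq_synth)
  then show ?thesis using assms(1-3) unfolding sup_stable_def by blast
qed

text \<open>Transplant windowed coefficients to \<Lambda>. The function they synthesise is small far
  out, where the sets are not compared, and uniformly continuous on the remaining compact interval,
  where points of the translated \<Lambda> are close to points of \<Gamma>. The windowing error can
  be made arbitrarily small, so the constant \<open>C\<close> survives unchanged.\<close>

lemma sup_stable_weak_limit:
  assumes C: "C > 0" and stab: "sup_stable \<Lambda> C" and \<Gamma>: "\<Gamma> \<in> WZ N \<Lambda>"
  shows "sup_stable \<Gamma> C"
proof -
  obtain s :: "nat \<Rightarrow> int" where
    s: "\<And>j. j < N \<Longrightarrow> weak_conv (\<lambda>n. (\<lambda>x. x + real_of_int (s n)) ` \<Lambda> j) (\<Gamma> j)"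
    using \<Gamma> unfolding WZ_def by blast
  have "norm (c m) \<le> C * D" if K: "\<And>k. norm (c k) \<le> K" and D: "0 \<le> D"
    and cD: "\<And>j x. j < N \<Longrightarrow> x \<in> \<Gamma> j \<Longrightarrow> norm (synth G c j x) \<le> D" for c K D m
  proof (rule field_le_epsilon)
    fix e0 :: real assume e0: "e0 > 0"
    define e where "e = e0 / C"
    have e: "e > 0" using e0 C by (simp add: e_def)
    have K0: "0 \<le> K" using K[of 0] norm_ge_zero order_trans by blast
    \<comment> \<open>The window is wide enough for the commutator term, at most
      \<open>csum L * K\<close>, to stay below \<open>e / 2\<close>; \<open>K + 1\<close> avoids
      division by zero.\<close>
    have "e / (2 * (K + 1)) > 0" using e K0 by simp
    then obtain L where L: "L > 0" "csum L < e / (2 * (K + 1))" by (rule csum_small)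
    have \<eta>: "csum L * K \<le> e / 2"
    proof -
      have "csum L * K \<le> e / (2 * (K + 1)) * K" using L(2) K0 by (intro mult_right_mono) auto
      also have "\<dots> = (e / 2) * (K / (K + 1))" by simp
      also have "\<dots> \<le> (e / 2) * 1" using e K0 by (intro mult_left_mono) auto
      finally show ?thesis by simp
    qed
    define c' where "c' k = of_real (window L m k) * c k" for k
    have c'K: "norm (c' k) \<le> K" for k unfolding c'_def using windowed_norm_le K order_trans by blast
    have c'0: "c' k = 0" if "k \<notin> near L m" for k
      using that window_eq_0[OF L(1), of k m] unfolding c'_def by force
    have c'\<Gamma>: "norm (synth G c' j x) \<le> D + e / 2" if "j < N" "x \<in> \<Gamma> j" for j x
    proof -
      have "norm (app c' (j, x)) \<le> window L m \<lfloor>x\<rfloor> * norm (app c (j, x)) + (\<Sum>\<^sub>\<infinity>k. cker L m \<lfloor>x\<rfloor> k * norm (c k))"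
        unfolding c'_def using commutator_le[OF L(1) K, of "(j, x)" m] that(1) by simp
      also have "window L m \<lfloor>x\<rfloor> * norm (app c (j, x)) \<le> 1 * D"
        using window_le_1 cD[OF that] D by (intro mult_mono) (auto simp: app_eq_synth)
      also have "(\<Sum>\<^sub>\<infinity>k. cker L m \<lfloor>x\<rfloor> k * norm (c k)) \<le> csum L * K"
        by (rule cker_weighted_sum_le[OF L(1)]) (use K in auto)
      finally show ?thesis using \<eta> by (simp add: app_eq_synth)
    qed
    have syn: "synth G c' j = (\<lambda>x. \<Sum>k\<in>near L m. c' k * G j (x - real_of_int k))" for j
    proof
      fix x
      have "synth G c' j x = (\<Sum>\<^sub>\<infinity>k\<in>near L m. c' k * G j (x - real_of_int k))"
        unfolding synth_def by (rule infsum_cong_neutral) (use c'0 in auto)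
      then show "synth G c' j x = (\<Sum>k\<in>near L m. c' k * G j (x - real_of_int k))" by simp
    qed
    have cont: "continuous_on A (synth G c' j)" if "j < N" for j A
      unfolding syn
      by (intro continuous_on_sum continuous_on_mult continuous_on_const
          continuous_on_compose2[OF continuous_G[OF that, of UNIV]] continuous_intros) auto
    have decay: "(synth G c' j \<longlongrightarrow> 0) at_infinity" if "j < N" for j
    proof -
      have "((\<lambda>x. \<Sum>k\<in>near L m. c' k * G j (x - real_of_int k)) \<longlongrightarrow> (\<Sum>k\<in>near L m. c' k * 0)) at_infinity"
      proof (intro tendsto_sum tendsto_mult tendsto_const)
        fix k
        have "filterlim (\<lambda>x::real. - real_of_int k + x) at_infinity at_infinity"
          by (rule tendsto_add_filterlim_at_infinity[OF tendsto_const filterlim_ident])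
        then show "((\<lambda>x. G j (x - real_of_int k)) \<longlongrightarrow> 0) at_infinity"
          using filterlim_compose[OF G_tendsto_0[OF that]] by fastforce
      qed
      then show ?thesis by (simp add: syn)
    qed
    have ev: "\<forall>\<^sub>F n in sequentially. \<forall>x\<in>\<Lambda> j. norm (synth G c' j (x + real_of_int (s n))) \<le> D + e" if j: "j < N" for j
    proof -
      have "\<forall>\<^sub>F x in at_infinity. dist (synth G c' j x) 0 < e" using decay[OF j] e by (rule tendstoD)
      then obtain T where T: "\<And>x. T \<le> \<bar>x\<bar> \<Longrightarrow> norm (synth G c' j x) < e"
        unfolding eventually_at_infinity by auto
      \<comment> \<open>The extra margin 1 keeps the approximating point of \<Gamma> inside the
        interval; this is why the distance is taken below \<open>min \<delta> 1\<close>.\<close>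
      have "uniformly_continuous_on {- T - 1..T + 1} (synth G c' j)"
        by (intro compact_uniformly_continuous cont j compact_Icc)
      then obtain \<delta> where \<delta>: "\<delta> > 0"
        "\<And>x y. x \<in> {- T - 1..T + 1} \<Longrightarrow> y \<in> {- T - 1..T + 1} \<Longrightarrow> dist x y < \<delta> \<Longrightarrow> dist (synth G c' j x) (synth G c' j y) < e / 2"
        unfolding uniformly_continuous_on_def using e by (metis half_gt_zero)
      obtain n0 where n0: "\<And>n. n \<ge> n0 \<Longrightarrow> (\<lambda>x. x + real_of_int (s n)) ` \<Lambda> j \<inter> {- T<..<T} \<subseteq> eps_nbhd (\<Gamma> j) (min \<delta> 1)"
        using s[OF j] \<delta>(1) unfolding weak_conv_def by (metis min_less_iff_conj zero_less_one)
      show ?thesis unfolding eventually_sequentially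
      proof (intro exI[of _ n0] allI impI ballI)
        fix n x assume n: "n \<ge> n0" and x: "x \<in> \<Lambda> j"
        define z where "z = x + real_of_int (s n)"
        show "norm (synth G c' j (x + real_of_int (s n))) \<le> D + e"
        proof (cases "T \<le> \<bar>z\<bar>")
          case True
          then show ?thesis using T[OF True] D by (simp add: z_def)
        next
          case False
          then have "z \<in> (\<lambda>x. x + real_of_int (s n)) ` \<Lambda> j \<inter> {- T<..<T}" using x by (auto simp: z_def)
          then obtain y where y: "y \<in> \<Gamma> j" "\<bar>z - y\<bar> < min \<delta> 1" using n0[OF n] by (auto simp: eps_nbhd_def)
          have "dist (synth G c' j z) (synth G c' j y) < e / 2"
            using y(2) False by (intro \<delta>(2)) (auto simp: dist_real_def)
          then have "norm (synth G c' j z) < norm (synth G c' j y) + e / 2"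
            unfolding dist_norm using norm_triangle_sub[of "synth G c' j z" "synth G c' j y"] by linarith
          then show ?thesis using c'\<Gamma>[OF j y(1)] by (simp add: z_def)
        qed
      qed
    qed
    have "\<forall>\<^sub>F n in sequentially. \<forall>j\<in>{..<N}. \<forall>x\<in>\<Lambda> j. norm (synth G c' j (x + real_of_int (s n))) \<le> D + e"
      using ev by (intro eventually_ball_finite) auto
    then obtain n where n: "\<And>j x. j < N \<Longrightarrow> x \<in> \<Lambda> j \<Longrightarrow> norm (synth G c' j (x + real_of_int (s n))) \<le> D + e"
      unfolding eventually_sequentially by blast
    \<comment> \<open>Shifting the coefficients by \<open>s n\<close> moves the evaluation from
      \<Lambda> to its translate, and index \<open>m - s n\<close> of the shifted sequence is index
      \<open>m\<close> of \<open>c'\<close>.\<close>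
    have "norm (c' ((m - s n) + s n)) \<le> C * (D + e)"
    proof (rule sup_stableD[OF stab, of "\<lambda>k. c' (k + s n)" K])
      show "norm (synth G (\<lambda>k. c' (k + s n)) j x) \<le> D + e" if "j < N" "x \<in> \<Lambda> j" for j x
        using n[OF that] by (simp add: synth_translate)
    qed (use c'K D e in auto)
    moreover have "c' m = c m" using window_eq_1[OF L(1), of m m] L(1) by (simp add: c'_def)
    ultimately show "norm (c m) \<le> C * D + e0" using C by (simp add: e_def distrib_left)
  qed
  then have *: "norm (c m) \<le> C * D" if "\<forall>k. norm (c k) \<le> K" "0 \<le> D"
    "\<forall>r\<in>Sigma {..<N} \<Gamma>. norm (app c r) \<le> D" for c K D m
    using that by (metis (no_types, lifting) app_eq_synth SigmaI lessThan_iff)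
  then show ?thesis unfolding sup_stable_def by blast
qed

end

section \<open>Extended norms and roots\<close>

lemma ennreal_mult_le_swap:
  assumes "A > 0" "ennreal A * x \<le> y"
  shows "x \<le> ennreal (1 / A) * y"
proof -
  have "x = ennreal (1 / A) * (ennreal A * x)"
    using assms(1) by (simp add: mult.assoc[symmetric] ennreal_mult[symmetric])
  also have "\<dots> \<le> ennreal (1 / A) * y" using assms(2) by (intro mult_left_mono) auto
  finally show ?thesis .
qed

lemma ennreal_mult_le_swap':
  assumes "B > 0" "x \<le> ennreal B * y"
  shows "ennreal (1 / B) * x \<le> y"
proof -
  have "ennreal (1 / B) * x \<le> ennreal (1 / B) * (ennreal B * y)" using assms(2) by (intro mult_left_mono) auto
  also have "\<dots> = y"
    using assms(1) by (simp add: mult.assoc[symmetric] ennreal_mult[symmetric])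
  finally show ?thesis .
qed

lemma enn2real_ge_1: "1 \<le> p \<Longrightarrow> p \<noteq> top \<Longrightarrow> 1 \<le> enn2real p"
  by (metis enn2real_mono enn2real_1 less_top)

lemma enn_root_less_top_iff: "enn_root p x < top \<longleftrightarrow> x < top"
  by (auto simp: enn_root_def less_top)

lemma enn_root_le_mult_iff:
  assumes "0 < enn2real p" "0 < C"
  shows "enn_root p x \<le> ennreal C * enn_root p y \<longleftrightarrow> x \<le> ennreal (C powr enn2real p) * y"
proof (cases "y = top")
  case True
  then show ?thesis using assms by (simp add: enn_root_def ennreal_mult_top)
next
  case False
  define q where "q = enn2real p"
  obtain y' where y': "y = ennreal y'" "0 \<le> y'" using False by (cases y) auto
  show ?thesis
  proof (cases "x = top")
    case True
    then show ?thesis using y' assms by (simp add: enn_root_def top_unique ennreal_mult_eq_top_iff)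
  next
    case False
    obtain x' where x': "x = ennreal x'" "0 \<le> x'" using False by (cases x) auto
    have q: "q > 0" using assms by (simp add: q_def)
    have "enn_root p x \<le> ennreal C * enn_root p y \<longleftrightarrow> x' powr (1/q) \<le> C * y' powr (1/q)"
      using x' y' assms by (simp add: enn_root_def q_def ennreal_mult[symmetric])
    also have "C * y' powr (1/q) = (C powr q * y') powr (1/q)"
      using assms y' q by (simp add: powr_mult powr_powr)
    also have "x' powr (1/q) \<le> (C powr q * y') powr (1/q) \<longleftrightarrow> x' \<le> C powr q * y'"
    proof
      assume "x' powr (1/q) \<le> (C powr q * y') powr (1/q)"
      then have "(x' powr (1/q)) powr q \<le> ((C powr q * y') powr (1/q)) powr q"
        by (rule powr_mono2[rotated 2]) (use q in auto)
      then show "x' \<le> C powr q * y'" using x' y' q by (simp add: powr_powr)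
    qed (use x' q in \<open>auto intro: powr_mono2\<close>)
    also have "\<dots> \<longleftrightarrow> x \<le> ennreal (C powr q) * y"
      using x' y' by (simp add: ennreal_mult[symmetric])
    finally show ?thesis by (simp add: q_def)
  qed
qed

lemma sum_nn_integral_count_space_Sigma:
  fixes f :: "nat \<Rightarrow> 'a \<Rightarrow> ennreal"
  shows "(\<Sum>j<N. \<integral>\<^sup>+x. f j x \<partial>count_space (\<Lambda> j)) = (\<integral>\<^sup>+(j, x). f j x \<partial>count_space (Sigma {..<N} \<Lambda>))"
proof -
  have "(\<integral>\<^sup>+(j, x). f j x \<partial>count_space (Sigma {..<N} \<Lambda>))
      = (\<integral>\<^sup>+z. (case z of (j, x) \<Rightarrow> f j x) * indicator (Sigma {..<N} \<Lambda>) z \<partial>count_space UNIV)"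
    by (simp add: nn_integral_count_space_indicator)
  also have "\<dots> = (\<integral>\<^sup>+j. \<integral>\<^sup>+x. f j x * indicator (Sigma {..<N} \<Lambda>) (j, x) \<partial>count_space UNIV \<partial>count_space UNIV)"
    by (simp add: nn_integral_fst_count_space[symmetric])
  also have "\<dots> = (\<integral>\<^sup>+j. (\<integral>\<^sup>+x. f j x \<partial>count_space (\<Lambda> j)) * indicator {..<N} j \<partial>count_space UNIV)"
    by (intro nn_integral_cong) (auto simp: nn_integral_count_space_indicator indicator_def intro!: nn_integral_cong)
  also have "\<dots> = (\<integral>\<^sup>+j. (\<integral>\<^sup>+x. f j x \<partial>count_space (\<Lambda> j)) \<partial>count_space {..<N})"
    by (simp add: nn_integral_count_space_indicator)
  also have "\<dots> = (\<Sum>j<N. \<integral>\<^sup>+x. f j x \<partial>count_space (\<Lambda> j))"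
    by (simp add: nn_integral_count_space_finite)
  finally show ?thesis ..
qed

lemma Lp_norm_cong: "(\<And>j. j < N \<Longrightarrow> F j = F' j) \<Longrightarrow> Lp_norm N p F = Lp_norm N p F'"
  unfolding Lp_norm_def by (auto intro!: arg_cong[where f = "enn_root p"] sum.cong SUP_cong)

lemma samp_norm_cong: "(\<And>j. j < N \<Longrightarrow> F j = F' j) \<Longrightarrow> samp_norm N p \<Lambda> F = samp_norm N p \<Lambda> F'"
  unfolding samp_norm_def by (auto intro!: arg_cong[where f = "enn_root p"] sum.cong SUP_cong)

lemma lp_norm_top_le_iff: "lp_norm top c \<le> ennreal K \<longleftrightarrow> (\<forall>k. ennreal (norm (c k)) \<le> ennreal K)"
  by (simp add: lp_norm_def SUP_le_iff)

lemma norm_le_lp_norm_top: "ennreal (norm (c k)) \<le> lp_norm top c"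
  unfolding lp_norm_def by (simp, rule SUP_upper) simp

lemma lp_norm_finite:
  "p \<noteq> top \<Longrightarrow> lp_norm p c = enn_root p (\<integral>\<^sup>+k. ennreal (norm (c k) powr enn2real p) \<partial>count_space UNIV)"
  by (simp add: lp_norm_def infsum_ennreal_eq_nn_integral)

lemma samp_norm_le_Lp_norm_top: "samp_norm N top \<Lambda> F \<le> Lp_norm N top F"
proof -
  have "(SUP l\<in>\<Lambda> j. ennreal (norm (F j l))) \<le> (SUP x. ennreal (norm (F j x)))" for j
    by (rule SUP_subset_mono) auto
  then show ?thesis unfolding samp_norm_def Lp_norm_def by (auto intro!: SUP_mono)
qed

section \<open>Sampling inequalities as lower bounds on coefficients\<close>

locale stable_generators = generators +
  assumes stable: "stable_shifts N G"
begin

text \<open>Stability of the shifts makes the norm of a function comparable with that of its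
  coefficients. Given the upper sampling estimate, only the lower one remains to be decided.\<close>

lemma sampling_set_iff_coefficients:
  assumes p: "1 \<le> p"
    and upper: "\<exists>U>0. \<forall>c. lp_norm p c < top \<longrightarrow> samp_norm N p \<Lambda> (synth G c) \<le> ennreal U * lp_norm p c"
  shows "sampling_set N p G \<Lambda> \<longleftrightarrow>
    (\<exists>C>0. \<forall>c. lp_norm p c < top \<longrightarrow> lp_norm p c \<le> ennreal C * samp_norm N p \<Lambda> (synth G c))"
proof -
  obtain A B :: real where AB: "0 < A" "0 < B"
    and lo: "\<And>c. lp_norm p c < top \<Longrightarrow> ennreal A * lp_norm p c \<le> Lp_norm N p (synth G c)"
    and up: "\<And>c. lp_norm p c < top \<Longrightarrow> Lp_norm N p (synth G c) \<le> ennreal B * lp_norm p c"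
    using stable p unfolding stable_shifts_def by metis
  obtain U where U: "U > 0" "\<And>c. lp_norm p c < top \<Longrightarrow> samp_norm N p \<Lambda> (synth G c) \<le> ennreal U * lp_norm p c"
    using upper by blast
  show ?thesis
  proof
    assume "sampling_set N p G \<Lambda>"
    then obtain A' :: real where A': "0 < A'" "\<And>F. F \<in> Vp N p G \<Longrightarrow> ennreal A' * Lp_norm N p F \<le> samp_norm N p \<Lambda> F"
      unfolding sampling_set_def by blast
    show "\<exists>C>0. \<forall>c. lp_norm p c < top \<longrightarrow> lp_norm p c \<le> ennreal C * samp_norm N p \<Lambda> (synth G c)"
    proof (intro exI[of _ "1 / A * (1 / A')"] conjI allI impI)
      fix c assume c: "lp_norm p c < top"
      then have "synth G c \<in> Vp N p G" unfolding Vp_def by blast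
      then have "Lp_norm N p (synth G c) \<le> ennreal (1 / A') * samp_norm N p \<Lambda> (synth G c)"
        by (intro ennreal_mult_le_swap A')
      moreover have "lp_norm p c \<le> ennreal (1 / A) * Lp_norm N p (synth G c)"
        by (intro ennreal_mult_le_swap AB lo c)
      ultimately have "lp_norm p c \<le> ennreal (1 / A) * (ennreal (1 / A') * samp_norm N p \<Lambda> (synth G c))"
        by (meson mult_left_mono order_trans zero_le)
      then show "lp_norm p c \<le> ennreal (1 / A * (1 / A')) * samp_norm N p \<Lambda> (synth G c)"
        using AB A'(1) by (subst ennreal_mult) (auto simp: mult.assoc)
    qed (use AB A' in simp)
  next
    assume "\<exists>C>0. \<forall>c. lp_norm p c < top \<longrightarrow> lp_norm p c \<le> ennreal C * samp_norm N p \<Lambda> (synth G c)"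
    then obtain C where C: "C > 0" "\<And>c. lp_norm p c < top \<Longrightarrow> lp_norm p c \<le> ennreal C * samp_norm N p \<Lambda> (synth G c)"
      by blast
    show "sampling_set N p G \<Lambda>"
      unfolding sampling_set_def
    \<comment> \<open>The chains are: function \<le> \<open>B\<close> * coefficients \<le>
      \<open>B * C\<close> * samples, and samples \<le> \<open>U\<close> * coefficients \<le>
      \<open>U / A\<close> * function.\<close>
    proof (rule exI[of _ "1 / (B * C)"], rule exI[of _ "U * (1 / A)"], intro conjI ballI)
      fix F assume "F \<in> Vp N p G"
      then obtain c where c: "lp_norm p c < top" and F: "\<And>j. j < N \<Longrightarrow> F j = synth G c j"
        unfolding Vp_def by blast
      have L: "Lp_norm N p F = Lp_norm N p (synth G c)" by (rule Lp_norm_cong[OF F])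
      have S: "samp_norm N p \<Lambda> F = samp_norm N p \<Lambda> (synth G c)" by (rule samp_norm_cong[OF F])
      have "Lp_norm N p F \<le> ennreal B * (ennreal C * samp_norm N p \<Lambda> F)"
        unfolding L S by (rule order_trans[OF up[OF c]]) (intro mult_left_mono C c, simp)
      then have "Lp_norm N p F \<le> ennreal (B * C) * samp_norm N p \<Lambda> F"
        using AB C(1) by (simp add: ennreal_mult mult.assoc)
      then show "ennreal (1 / (B * C)) * Lp_norm N p F \<le> samp_norm N p \<Lambda> F"
        using AB C(1) by (intro ennreal_mult_le_swap') auto
      have "lp_norm p c \<le> ennreal (1 / A) * Lp_norm N p F"
        unfolding L by (intro ennreal_mult_le_swap AB lo c)
      then have "samp_norm N p \<Lambda> F \<le> ennreal U * (ennreal (1 / A) * Lp_norm N p F)"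
        unfolding S using U(2)[OF c] by (meson mult_left_mono order_trans zero_le)
      then show "samp_norm N p \<Lambda> F \<le> ennreal (U * (1 / A)) * Lp_norm N p F"
        using AB U(1) by (subst ennreal_mult) (auto simp: mult.assoc)
    qed (use AB C U in simp_all)
  qed
qed

text \<open>For the supremum norm the samples are trivially bounded by the function, so sampling
  reduces to the lower coefficient bound, here restated with real bounds.\<close>

lemma sampling_set_top_iff: "sampling_set N top G \<Lambda> \<longleftrightarrow> (\<exists>C>0. sup_stable \<Lambda> C)"
proof -
  obtain B :: real where B: "0 < B" "\<And>c. lp_norm top c < top \<Longrightarrow> Lp_norm N top (synth G c) \<le> ennreal B * lp_norm top c"
    using stable unfolding stable_shifts_def by (metis top_greatest)
  have "sampling_set N top G \<Lambda> \<longleftrightarrow>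
    (\<exists>C>0. \<forall>c. lp_norm top c < top \<longrightarrow> lp_norm top c \<le> ennreal C * samp_norm N top \<Lambda> (synth G c))"
    using B by (intro sampling_set_iff_coefficients) (auto intro: order_trans[OF samp_norm_le_Lp_norm_top])
  also have "\<dots> \<longleftrightarrow> (\<exists>C>0. sup_stable \<Lambda> C)"
  proof (intro arg_cong[where f = Ex] ext conj_cong refl iffI)
    fix C :: real
    assume C: "C > 0" and *: "\<forall>c. lp_norm top c < top \<longrightarrow> lp_norm top c \<le> ennreal C * samp_norm N top \<Lambda> (synth G c)"
    show "sup_stable \<Lambda> C"
      unfolding sup_stable_def
    proof (intro allI impI)
      fix c :: "int \<Rightarrow> complex" and K D k
      assume K: "\<forall>k. norm (c k) \<le> K" and D: "0 \<le> D" and cD: "\<forall>r\<in>Sigma {..<N} \<Lambda>. norm (app c r) \<le> D"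
      have "lp_norm top c \<le> ennreal K" using K by (simp add: lp_norm_top_le_iff ennreal_leI)
      then have "lp_norm top c < top" by (rule le_less_trans) simp
      then have "ennreal (norm (c k)) \<le> ennreal C * samp_norm N top \<Lambda> (synth G c)"
        using * norm_le_lp_norm_top order_trans by blast
      also have "samp_norm N top \<Lambda> (synth G c) \<le> ennreal D"
        unfolding samp_norm_def using cD by (auto intro!: SUP_least ennreal_leI simp: app_eq_synth)
      also have "ennreal C * ennreal D = ennreal (C * D)" using C D by (simp add: ennreal_mult)
      finally show "norm (c k) \<le> C * D" using C D by (simp add: mult_left_mono)
    qed
  next
    fix C :: real
    assume C: "C > 0" and st: "sup_stable \<Lambda> C"
    show "\<forall>c. lp_norm top c < top \<longrightarrow> lp_norm top c \<le> ennreal C * samp_norm N top \<Lambda> (synth G c)"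
    proof (intro allI impI)
      fix c assume c: "lp_norm top c < top"
      define K where "K = enn2real (lp_norm top c)"
      have K: "norm (c k) \<le> K" for k
        using norm_le_lp_norm_top[of c k] c unfolding K_def by (metis enn2real_mono enn2real_ennreal norm_ge_zero)
      define s where "s = samp_norm N top \<Lambda> (synth G c)"
      show "lp_norm top c \<le> ennreal C * samp_norm N top \<Lambda> (synth G c)"
      proof (cases "s = top")
        case True
        then show ?thesis using C by (simp add: s_def ennreal_mult_top)
      next
        case False
        then obtain D where D: "s = ennreal D" "0 \<le> D" by (cases s) auto
        have "norm (synth G c j x) \<le> D" if "j < N" "x \<in> \<Lambda> j" for j x
        proof -
          have "ennreal (norm (synth G c j x)) \<le> (SUP l\<in>\<Lambda> j. ennreal (norm (synth G c j l)))"
            by (rule SUP_upper[OF that(2)])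
          also have "\<dots> \<le> s"
            unfolding s_def samp_norm_def using that(1)
            by (simp add: SUP_upper[where f = "\<lambda>j. SUP l\<in>\<Lambda> j. ennreal (norm (synth G c j l))"])
          finally show ?thesis using D by simp
        qed
        then have "norm (c k) \<le> C * D" for k by (rule sup_stableD[OF st K D(2)])
        then have "lp_norm top c \<le> ennreal (C * D)" by (simp add: lp_norm_top_le_iff ennreal_leI)
        then show ?thesis using C D by (simp add: ennreal_mult flip: s_def)
      qed
    qed
  qed
  finally show ?thesis .
qed

lemma samp_norm_finite:
  assumes "p \<noteq> top"
  shows "samp_norm N p \<Lambda> (synth G c)
    = enn_root p (\<integral>\<^sup>+r. ennreal (norm (app c r) powr enn2real p) \<partial>count_space (Sigma {..<N} \<Lambda>))"
proof -
  have "(\<Sum>j<N. \<Sum>\<^sub>\<infinity>l\<in>\<Lambda> j. ennreal (norm (synth G c j l) powr enn2real p))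
     = (\<integral>\<^sup>+(j, x). ennreal (norm (synth G c j x) powr enn2real p) \<partial>count_space (Sigma {..<N} \<Lambda>))"
    by (simp add: infsum_ennreal_eq_nn_integral sum_nn_integral_count_space_Sigma)
  also have "\<dots> = (\<integral>\<^sup>+r. ennreal (norm (app c r) powr enn2real p) \<partial>count_space (Sigma {..<N} \<Lambda>))"
    by (rule nn_integral_cong) (auto simp: app_eq_synth)
  finally show ?thesis using assms by (simp add: samp_norm_def)
qed

lemma rows_fiber_card:
  assumes "\<forall>j<N. separated (\<Lambda> j)"
  obtains \<nu> where "\<And>n::int. finite {r \<in> Sigma {..<N} \<Lambda>. (case r of (j, x) \<Rightarrow> \<lfloor>x\<rfloor>) = n}"
    "\<And>n. card {r \<in> Sigma {..<N} \<Lambda>. (case r of (j, x) \<Rightarrow> \<lfloor>x\<rfloor>) = n} \<le> \<nu>"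
proof -
  have "\<forall>j\<in>{..<N}. \<exists>\<nu>. \<forall>n::int. finite {x \<in> \<Lambda> j. \<lfloor>x\<rfloor> = n} \<and> card {x \<in> \<Lambda> j. \<lfloor>x\<rfloor> = n} \<le> \<nu>"
    using assms separated_fiber_card by (metis lessThan_iff)
  then obtain \<nu> where \<nu>: "\<And>j n. j < N \<Longrightarrow> finite {x \<in> \<Lambda> j. \<lfloor>x\<rfloor> = (n::int)}"
    "\<And>j n. j < N \<Longrightarrow> card {x \<in> \<Lambda> j. \<lfloor>x\<rfloor> = (n::int)} \<le> \<nu> j"
    unfolding bchoice_iff by auto
  have eq: "{r \<in> Sigma {..<N} \<Lambda>. (case r of (j, x) \<Rightarrow> \<lfloor>x\<rfloor>) = n} = (SIGMA j:{..<N}. {x \<in> \<Lambda> j. \<lfloor>x\<rfloor> = n})" for n :: int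
    by auto
  show ?thesis
  proof (rule that[of "\<Sum>j<N. \<nu> j"], unfold eq)
    show "finite (SIGMA j:{..<N}. {x \<in> \<Lambda> j. \<lfloor>x\<rfloor> = n})" for n :: int
      using \<nu>(1) by (intro finite_SigmaI) auto
    show "card (SIGMA j:{..<N}. {x \<in> \<Lambda> j. \<lfloor>x\<rfloor> = n}) \<le> (\<Sum>j<N. \<nu> j)" for n :: int
      using \<nu> by (subst card_SigmaI) (auto intro!: sum_mono)
  qed
qed

lemma sampling_set_finite_iff:
  assumes p: "1 \<le> p" "p \<noteq> top" and sep: "\<forall>j<N. separated (\<Lambda> j)"
  defines "q \<equiv> enn2real p"
  shows "sampling_set N p G \<Lambda> \<longleftrightarrow> (\<exists>C>0. \<forall>c. (\<integral>\<^sup>+k. ennreal (norm (c k) powr q) \<partial>count_space UNIV) < top \<longrightarrow>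
     (\<integral>\<^sup>+k. ennreal (norm (c k) powr q) \<partial>count_space UNIV)
       \<le> ennreal C * (\<integral>\<^sup>+r. ennreal (norm (app c r) powr q) \<partial>count_space (Sigma {..<N} \<Lambda>)))"
    (is "_ \<longleftrightarrow> (\<exists>C>0. \<forall>c. ?l c < top \<longrightarrow> ?l c \<le> ennreal C * ?s c)")
proof -
  have q: "1 \<le> q" using p unfolding q_def by (rule enn2real_ge_1)
  have root: "enn_root p x \<le> ennreal C * enn_root p y \<longleftrightarrow> x \<le> ennreal (C powr q) * y" if "C > 0" for C x y
    using enn_root_le_mult_iff[of p C x y] q that by (simp add: q_def)
  have lp: "lp_norm p c = enn_root p (?l c)" for c using p(2) by (simp add: lp_norm_finite q_def)
  have sm: "samp_norm N p \<Lambda> (synth G c) = enn_root p (?s c)" for c using p(2) by (simp add: samp_norm_finite q_def)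
  have upper: "\<exists>U>0. \<forall>c. lp_norm p c < top \<longrightarrow> samp_norm N p \<Lambda> (synth G c) \<le> ennreal U * lp_norm p c"
  proof -
    obtain \<nu> where \<nu>: "\<And>n::int. finite {r \<in> Sigma {..<N} \<Lambda>. (case r of (j, x) \<Rightarrow> \<lfloor>x\<rfloor>) = n}"
      "\<And>n. card {r \<in> Sigma {..<N} \<Lambda>. (case r of (j, x) \<Rightarrow> \<lfloor>x\<rfloor>) = n} \<le> \<nu>"
      using rows_fiber_card[OF sep] by blast
    \<comment> \<open>The bound from \<open>app_lp_bounded\<close>, increased by 1 so that it is
      positive.\<close>
    define V where "V = infsum env UNIV powr (q - 1) * \<nu> * infsum env UNIV + 1"
    have "0 \<le> infsum env UNIV" by (intro infsum_nonneg env_nonneg)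
    then have V: "V > 0" by (simp add: V_def add_nonneg_pos)
    have "?s c \<le> ennreal V * ?l c" if c: "?l c < top" for c
    proof -
      obtain K where K: "\<And>k. norm (c k) \<le> K"
        using norm_powr_summable_imp_bounded[OF c] q by auto
      have "?s c \<le> ennreal (infsum env UNIV powr (q - 1) * \<nu> * infsum env UNIV) * ?l c"
        by (rule app_lp_bounded[OF _ \<nu> q K]) auto
      also have "\<dots> \<le> ennreal V * ?l c" by (intro mult_right_mono ennreal_leI) (auto simp: V_def)
      finally show ?thesis .
    qed
    then have "enn_root p (?s c) \<le> ennreal (V powr (1/q)) * enn_root p (?l c)" if "?l c < top" for c
      using that V q by (subst root) (auto simp: powr_powr)
    then show ?thesis unfolding lp sm enn_root_less_top_iff using V
      by (intro exI[of _ "V powr (1/q)"]) auto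
  qed
  have "sampling_set N p G \<Lambda> \<longleftrightarrow> (\<exists>C>0. \<forall>c. ?l c < top \<longrightarrow> enn_root p (?l c) \<le> ennreal C * enn_root p (?s c))"
    using sampling_set_iff_coefficients[OF p(1) upper] by (simp only: lp sm enn_root_less_top_iff)
  also have "\<dots> \<longleftrightarrow> (\<exists>C>0. \<forall>c. ?l c < top \<longrightarrow> ?l c \<le> ennreal C * ?s c)"
  proof
    assume "\<exists>C>0. \<forall>c. ?l c < top \<longrightarrow> enn_root p (?l c) \<le> ennreal C * enn_root p (?s c)"
    then obtain C where "C > 0" "\<forall>c. ?l c < top \<longrightarrow> enn_root p (?l c) \<le> ennreal C * enn_root p (?s c)" by blast
    then show "\<exists>C>0. \<forall>c. ?l c < top \<longrightarrow> ?l c \<le> ennreal C * ?s c"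
      by (intro exI[of _ "C powr q"]) (simp add: root)
  next
    assume "\<exists>C>0. \<forall>c. ?l c < top \<longrightarrow> ?l c \<le> ennreal C * ?s c"
    then obtain C where C: "C > 0" "\<forall>c. ?l c < top \<longrightarrow> ?l c \<le> ennreal C * ?s c" by blast
    then have "\<forall>c. ?l c < top \<longrightarrow> enn_root p (?l c) \<le> ennreal (C powr (1/q)) * enn_root p (?s c)"
      using q by (simp add: root powr_powr)
    then show "\<exists>C>0. \<forall>c. ?l c < top \<longrightarrow> enn_root p (?l c) \<le> ennreal C * enn_root p (?s c)"
      using C(1) by (intro exI[of _ "C powr (1/q)"]) auto
  qed
  finally show ?thesis .
qed

text \<open>Take a violation of the bound with constant \<open>n + 1\<close>, divide by the supremum
  \<open>M\<close> of the coefficients, and translate an index with coefficient above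
  \<open>M / 2\<close> to 0. The samples become at most \<open>D / M\<close>, below
  \<open>1 / (n + 1)\<close>. The translation integer also shifts \<Lambda>, which produces the
  sequence in \<open>WZ\<close>.\<close>

lemma not_sup_stable_witness:
  assumes "\<not> (\<exists>C>0. sup_stable \<Lambda> C)"
  shows "\<exists>d (s::int). (\<forall>k. norm (d k) \<le> 1) \<and> 1/2 \<le> norm (d 0) \<and>
     (\<forall>j<N. \<forall>x\<in>(\<lambda>x. x + real_of_int s) ` \<Lambda> j. norm (synth G d j x) \<le> inverse (real (Suc n)))"
proof -
  have "\<not> sup_stable \<Lambda> (real (Suc n))" using assms by (metis of_nat_0_less_iff zero_less_Suc)
  then obtain c K D k where K: "\<And>k. norm (c k) \<le> K" and D: "0 \<le> D"
    and cD: "\<And>r. r \<in> Sigma {..<N} \<Lambda> \<Longrightarrow> norm (app c r) \<le> D" and k: "real (Suc n) * D < norm (c k)"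
    unfolding sup_stable_def not_all not_imp not_le by blast
  define M where "M = (SUP k. norm (c k))"
  have bdd: "bdd_above (range (\<lambda>k. norm (c k)))" using K by (intro bdd_aboveI[of _ K]) auto
  have le: "norm (c k) \<le> M" for k unfolding M_def by (rule cSUP_upper[OF _ bdd]) simp
  have MD: "real (Suc n) * D < M" using k le[of k] by linarith
  then have M0: "M > 0" using D by (smt (verit) mult_nonneg_nonneg of_nat_0_le_iff)
  have "M / 2 < (SUP k. norm (c k))" using M0 by (simp add: M_def)
  then obtain m where m: "M / 2 < norm (c m)" using bdd by (subst (asm) less_cSUP_iff) auto
  define d where "d i = c (i + m) / of_real M" for i
  have syn: "synth G d j (x - real_of_int m) = synth G c j x / of_real M" for j x
  proof -
    have "synth G d j (x - real_of_int m) = synth G (\<lambda>i. c i / of_real M) j x"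
      using synth_translate[of "\<lambda>i. c i / of_real M" j "x - real_of_int m" m] by (simp add: d_def[abs_def])
    also have "\<dots> = (\<Sum>\<^sub>\<infinity>k. c k * G j (x - real_of_int k) * inverse (of_real M))"
      unfolding synth_def by (rule infsum_cong) (simp add: field_simps)
    also have "\<dots> = synth G c j x * inverse (of_real M)"
      unfolding synth_def by (rule infsum_cmult_left')
    finally show ?thesis by (simp add: field_simps)
  qed
  show ?thesis
  proof (intro exI[of _ d] exI[of _ "- m"] conjI allI impI ballI)
    show "norm (d i) \<le> 1" for i using le[of "i + m"] M0 by (simp add: d_def norm_divide)
    show "1/2 \<le> norm (d 0)" using m M0 by (simp add: d_def norm_divide field_simps)
    fix j x assume j: "j < N" and "x \<in> (\<lambda>x. x + real_of_int (- m)) ` \<Lambda> j"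
    then obtain z where z: "z \<in> \<Lambda> j" "x = z - real_of_int m" by auto
    have "norm (synth G d j x) = norm (synth G c j z) / M"
      using M0 by (simp add: z(2) syn norm_divide)
    also have "\<dots> \<le> D / M" using cD[of "(j, z)"] j z(1) M0 by (simp add: app_eq_synth divide_right_mono)
    also have "\<dots> \<le> inverse (real (Suc n))" using MD M0 by (simp add: field_simps)
    finally show "norm (synth G d j x) \<le> inverse (real (Suc n))" .
  qed
qed

text \<open>Compactness: extract first a pointwise limit of the witnesses' coefficients, then, along
  that subsequence, a weak limit of the translated sets. The samples tend to 0, so the limit
  function vanishes on a weak limit of \<Lambda>, while the bound at index 0 keeps its coefficients
  nonzero.\<close>

lemma uniqueness_imp_sup_stable:
  assumes uniq: "\<forall>\<Gamma>\<in>WZ N \<Lambda>. uniqueness_set N top G \<Gamma>"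
  shows "\<exists>C>0. sup_stable \<Lambda> C"
proof (rule ccontr)
  assume neg: "\<not> (\<exists>C>0. sup_stable \<Lambda> C)"
  obtain d :: "nat \<Rightarrow> int \<Rightarrow> complex" and s :: "nat \<Rightarrow> int" where d1: "\<And>n k. norm (d n k) \<le> 1"
    and d0: "\<And>n. 1/2 \<le> norm (d n 0)"
    and small: "\<And>n j x. j < N \<Longrightarrow> x \<in> (\<lambda>x. x + real_of_int (s n)) ` \<Lambda> j \<Longrightarrow> norm (synth G (d n) j x) \<le> inverse (real (Suc n))"
    using not_sup_stable_witness[OF neg] by metis
  obtain r1 where r1: "strict_mono r1" "\<And>k. convergent (\<lambda>n. d (r1 n) k)"
  proof (rule countable_pointwise_convergent_subsequence[of d])
    show "bounded (range (\<lambda>n. d n k))" for k by (rule boundedI[of _ 1]) (use d1 in auto)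
  qed (use that in blast)
  obtain r2 \<Gamma> where r2: "strict_mono r2"
    and \<Gamma>: "\<And>j. weak_conv (\<lambda>n. (\<lambda>x. x + real_of_int (s (r1 (r2 n)))) ` \<Lambda> j) (\<Gamma> j)"
    using weak_conv_subsequence[of "\<lambda>n j. (\<lambda>x. x + real_of_int (s (r1 n))) ` \<Lambda> j"] by blast
  define r where "r n = r1 (r2 n)" for n
  have r: "strict_mono r" using strict_mono_o[OF r1(1) r2] unfolding r_def o_def .
  have "\<exists>l. (\<lambda>n. d (r n) k) \<longlonglongrightarrow> l" for k
    using convergent_subseq_convergent[OF r1(2)[of k] r2] by (simp add: o_def r_def convergent_def)
  then obtain d' where d': "\<And>k. (\<lambda>n. d (r n) k) \<longlonglongrightarrow> d' k" by metis
  have d'1: "norm (d' k) \<le> 1" for k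
    using tendsto_norm[OF d'[of k]] d1 by (intro LIMSEQ_le_const2) auto
  have d'0: "1/2 \<le> norm (d' 0)"
    using tendsto_norm[OF d'[of 0]] d0 by (intro LIMSEQ_le_const) auto
  have WZ: "\<Gamma> \<in> WZ N \<Lambda>"
    unfolding WZ_def using \<Gamma> by (intro CollectI exI[of _ "\<lambda>n. s (r1 (r2 n))"]) simp
  have vanish: "synth G d' j x = 0" if j: "j < N" and x: "x \<in> \<Gamma> j" for j x
  proof -
    obtain y where y: "\<forall>\<^sub>F n in sequentially. y n \<in> (\<lambda>x. x + real_of_int (s (r n))) ` \<Lambda> j" "y \<longlonglongrightarrow> x"
      using weak_conv_approx[OF \<Gamma> x] unfolding r_def by blast
    have "(\<lambda>n. synth G (d (r n)) j (y n)) \<longlonglongrightarrow> synth G d' j x"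
      by (rule synth_tendsto[OF d1 d' y(2) j])
    moreover have "(\<lambda>n. synth G (d (r n)) j (y n)) \<longlonglongrightarrow> 0"
    proof (rule Lim_null_comparison)
      show "\<forall>\<^sub>F n in sequentially. norm (synth G (d (r n)) j (y n)) \<le> inverse (real (Suc (r n)))"
        using y(1) by eventually_elim (use small[OF j] in blast)
      show "(\<lambda>n. inverse (real (Suc (r n)))) \<longlonglongrightarrow> 0"
        using LIMSEQ_subseq_LIMSEQ[OF LIMSEQ_inverse_real_of_nat r] by (simp add: o_def)
    qed
    ultimately show ?thesis by (rule LIMSEQ_unique)
  qed
  have fin: "lp_norm top d' < top"
  proof -
    have "lp_norm top d' \<le> ennreal 1" unfolding lp_norm_top_le_iff using d'1 by (auto intro: ennreal_leI simp del: ennreal_1)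
    then show ?thesis by (rule le_less_trans) simp
  qed
  then have "synth G d' \<in> Vp N top G" unfolding Vp_def by blast
  then have zero: "\<forall>j<N. \<forall>x. synth G d' j x = 0"
    using uniq WZ vanish unfolding uniqueness_set_def by blast
  \<comment> \<open>The lower stability bound for the supremum norm makes synthesis injective, so a
    vanishing function would force \<open>d'\<close> to be 0.\<close>
  obtain A :: real where A: "0 < A" "ennreal A * lp_norm top d' \<le> Lp_norm N top (synth G d')"
    using stable fin unfolding stable_shifts_def by (metis top_greatest)
  have "Lp_norm N top (synth G d') \<le> 0"
    unfolding Lp_norm_def if_P[OF refl] by (intro SUP_least) (use zero in simp)
  then have "lp_norm top d' = 0" using A by simp
  then have "norm (d' 0) = 0" using norm_le_lp_norm_top[of d' 0] by simp
  then show False using d'0 by simp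
qed

lemma sampling_imp_uniqueness_top:
  assumes "sampling_set N top G \<Gamma>"
  shows "uniqueness_set N top G \<Gamma>"
  unfolding uniqueness_set_def
proof (intro ballI impI allI)
  fix F j x assume F: "F \<in> Vp N top G" and 0: "\<forall>j<N. \<forall>l\<in>\<Gamma> j. F j l = 0" and j: "j < N"
  obtain A :: real where A: "0 < A" "ennreal A * Lp_norm N top F \<le> samp_norm N top \<Gamma> F"
    using assms F unfolding sampling_set_def by blast
  have "samp_norm N top \<Gamma> F \<le> 0"
    unfolding samp_norm_def if_P[OF refl] by (intro SUP_least) (use 0 in simp)
  then have "Lp_norm N top F = 0" using A by simp
  moreover have "ennreal (norm (F j x)) \<le> Lp_norm N top F"
  proof -
    have "ennreal (norm (F j x)) \<le> (SUP x. ennreal (norm (F j x)))" by (rule SUP_upper) simp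
    also have "\<dots> \<le> Lp_norm N top F"
      unfolding Lp_norm_def using j by (simp add: SUP_upper[where f = "\<lambda>j. SUP x. ennreal (norm (F j x))"])
    finally show ?thesis .
  qed
  ultimately show "F j x = 0" by simp
qed

lemma sampling_finite_imp_sup_stable:
  assumes p: "1 \<le> p" "p \<noteq> top" and sep: "\<forall>j<N. separated (\<Lambda> j)" and samp: "sampling_set N p G \<Lambda>"
  shows "\<exists>C>0. sup_stable \<Lambda> C"
proof -
  define q where "q = enn2real p"
  have q: "1 \<le> q" using p unfolding q_def by (rule enn2real_ge_1)
  obtain \<nu> where \<nu>: "\<And>n::int. finite {r \<in> Sigma {..<N} \<Lambda>. (case r of (j, x) \<Rightarrow> \<lfloor>x\<rfloor>) = n}"
    "\<And>n. card {r \<in> Sigma {..<N} \<Lambda>. (case r of (j, x) \<Rightarrow> \<lfloor>x\<rfloor>) = n} \<le> \<nu>"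
    using rows_fiber_card[OF sep] by blast
  obtain C where C: "C > 0" "\<And>c. (\<integral>\<^sup>+k. ennreal (norm (c k) powr q) \<partial>count_space UNIV) < top \<Longrightarrow>
     (\<integral>\<^sup>+k. ennreal (norm (c k) powr q) \<partial>count_space UNIV)
       \<le> ennreal C * (\<integral>\<^sup>+r. ennreal (norm (app c r) powr q) \<partial>count_space (Sigma {..<N} \<Lambda>))"
    using samp sampling_set_finite_iff[OF p sep] unfolding q_def by blast
  have "\<exists>C'>0. \<forall>c K D k. (\<forall>k. norm (c k) \<le> K) \<longrightarrow> 0 \<le> D \<longrightarrow>
      (\<forall>r\<in>Sigma {..<N} \<Lambda>. norm (app c r) \<le> D) \<longrightarrow> norm (c k) \<le> C' * D"
  proof (rule lp_stable_imp_sup_stable[OF _ \<nu> C(1) q])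
    fix c :: "int \<Rightarrow> complex" assume c: "finite {k. c k \<noteq> 0}"
    have "(\<integral>\<^sup>+k. ennreal (norm (c k) powr q) \<partial>count_space UNIV) = (\<Sum>k | c k \<noteq> 0. ennreal (norm (c k) powr q))"
      by (rule nn_integral_count_space') (use c q in auto)
    also have "\<dots> < top" using c by simp
    finally show "(\<integral>\<^sup>+k. ennreal (norm (c k) powr q) \<partial>count_space UNIV)
       \<le> ennreal C * (\<integral>\<^sup>+r. ennreal (norm (app c r) powr q) \<partial>count_space (Sigma {..<N} \<Lambda>))"
      by (rule C(2))
  qed auto
  then show ?thesis unfolding sup_stable_def .
qed

lemma sup_stable_imp_sampling:
  assumes p: "1 \<le> p" and sep: "\<forall>j<N. separated (\<Lambda> j)" and C: "C > 0" "sup_stable \<Lambda> C"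
  shows "sampling_set N p G \<Lambda>"
proof (cases "p = top")
  case True
  then show ?thesis using C sampling_set_top_iff by blast
next
  case False
  have q: "1 \<le> enn2real p" using p False by (rule enn2real_ge_1)
  show ?thesis
    unfolding sampling_set_finite_iff[OF p False sep]
  proof (rule sup_stable_imp_lq_stable[OF _ C(1) q])
    show "norm (c k) \<le> C * D" if "\<forall>k. norm (c k) \<le> K" "0 \<le> D" "\<forall>r\<in>Sigma {..<N} \<Lambda>. norm (app c r) \<le> D"
      for c K D k using C(2) that unfolding sup_stable_def by blast
  qed auto
qed

end

theorem theorem2p1:
  fixes N :: nat and G :: "nat \<Rightarrow> real \<Rightarrow> complex" and \<Lambda> :: "nat \<Rightarrow> real set"
  assumes "0 < N"
    and "\<forall>j<N. W0 (G j)"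
    and "stable_shifts N G"
    and "\<forall>j<N. separated (\<Lambda> j)"
  shows "((\<exists>p::ennreal. 1 \<le> p \<and> sampling_set N p G \<Lambda>)
            \<longleftrightarrow> (\<forall>p::ennreal. 1 \<le> p \<longrightarrow> sampling_set N p G \<Lambda>))
       \<and> ((\<exists>p::ennreal. 1 \<le> p \<and> sampling_set N p G \<Lambda>)
            \<longleftrightarrow> (\<forall>\<Gamma>\<in>WZ N \<Lambda>. sampling_set N top G \<Gamma>))
       \<and> ((\<exists>p::ennreal. 1 \<le> p \<and> sampling_set N p G \<Lambda>)
            \<longleftrightarrow> (\<forall>\<Gamma>\<in>WZ N \<Lambda>. uniqueness_set N top G \<Gamma>))"
proof -
  interpret stable_generators N G by unfold_locales (use assms in auto)
  let ?st = "\<exists>C>0. sup_stable \<Lambda> C"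
  have a: "?st" if "1 \<le> p" "sampling_set N p G \<Lambda>" for p
    using that sampling_finite_imp_sup_stable[of p \<Lambda>] sampling_set_top_iff[of \<Lambda>] assms(4) by (cases "p = top") auto
  have b: "sampling_set N p G \<Lambda>" if "?st" "1 \<le> p" for p
    using sup_stable_imp_sampling[OF that(2) assms(4)] that(1) by blast
  have c: "sampling_set N top G \<Gamma>" if "?st" "\<Gamma> \<in> WZ N \<Lambda>" for \<Gamma>
    using that sup_stable_weak_limit sampling_set_top_iff by blast
  have d: "uniqueness_set N top G \<Gamma>" if "sampling_set N top G \<Gamma>" for \<Gamma>
    by (rule sampling_imp_uniqueness_top[OF that])
  have e: ?st if "\<forall>\<Gamma>\<in>WZ N \<Lambda>. uniqueness_set N top G \<Gamma>"
    by (rule uniqueness_imp_sup_stable[OF that])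
  \<comment> \<open>The exponent 1 witnesses that validity for all exponents gives validity for
    some.\<close>
  have 1: "(1::ennreal) \<le> 1" by simp
  have A: "(\<exists>p::ennreal. 1 \<le> p \<and> sampling_set N p G \<Lambda>) \<longleftrightarrow> ?st" using a b 1 by blast
  have B: "(\<forall>p::ennreal. 1 \<le> p \<longrightarrow> sampling_set N p G \<Lambda>) \<longleftrightarrow> ?st" using a b 1 by blast
  \<comment> \<open>The last two conditions close a cycle: stability passes to weak limits, sampling
    gives uniqueness, and uniqueness for all weak limits gives stability back.\<close>
  have C: "(\<forall>\<Gamma>\<in>WZ N \<Lambda>. sampling_set N top G \<Gamma>) \<longleftrightarrow> ?st" using c d e by blast
  have D: "(\<forall>\<Gamma>\<in>WZ N \<Lambda>. uniqueness_set N top G \<Gamma>) \<longleftrightarrow> ?st" using c d e by blast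
  show ?thesis unfolding A B C D by simp
qed

end
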